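(* Let $\alpha$ satisfy $0<\alpha \le \frac{\min_i w_{ii}}{3\lambda_1(2K-1)}$, where $\lambda_1$ is the largest eigenvalue of $\mathbf{C}$ and $K$ is the number of eigenvectors to be estimated. Assume that for every node $i$, $\mathbf{q}_1^{T}\mathbf{x}_{i,1}^{(0)}\neq 0$ and $\|\mathbf{x}_{i,1}^{(0)}\|=1$, with $\mathbf{x}_{i,1}^{(0)}=\mathbf{x}_{\mathrm{init},1}$ the same at all nodes. Let $\mathbf{x}_{i,1}^{(t)}$, $i=1,\dots,M$, be the DSA iterates $$\mathbf{x}_{i,1}^{(t+1)}=\sum_{j\in\mathcal{N}_i\cup\{i\}}w_{ij}\mathbf{x}_{j,1}^{(t)}+\alpha\Big(\mathbf{C}_i\mathbf{x}_{i,1}^{(t)}-\big((\mathbf{x}_{i,1}^{(t)})^{T}\mathbf{C}_i\mathbf{x}_{i,1}^{(t)}\big)\mathbf{x}_{i,1}^{(t)}\Big).$$ Then at every node $\mathbf{x}_{i,1}^{(t)}$ converges at a linear rate to an $\mathcal{O}(\alpha)$ neighborhood of $\pm\mathbf{q}_1$, the eigenvector of $\mathbf{C}$ corresponding to its largest eigenvalue $\lambda_1$. That is, there is a constant $B>0$, independent of $\alpha$, $t$ and $i$, such that for every $\alpha$ with $0<\alpha\le\frac{\min_i w_{ii}}{3\lambda_1(2K-1)}$ there are $A>0$, $\theta\in(0,1)$ and $\mathbf{x}_1^*\in\{\mathbf{q}_1,-\mathbf{q}_1\}$ (independent of $t$ and $i$) with $$\|\mathbf{x}_{i,1}^{(t)}-\mathbf{x}_1^*\|\le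 A\,\theta^{t}+B\,\alpha\qquad\text{for all } t\ge 0,\ i=1,\dots,M.$$
   Context: Distributed setting: $\mathcal{G}$ is a connected undirected graph on nodes $\{1,\dots,M\}$, and $\mathcal{N}_i$ is the set of neighbors of node $i$. $\mathbf{W}=[w_{ij}]\in\mathbb{R}^{M\times M}$ is a symmetric doubly stochastic matrix with nonnegative entries such that, for $i\ne j$, $w_{ij}\neq 0$ if and only if $(i,j)$ is an edge, and $w_{ii}\ne 0$ for all $i$. Consequently $\beta=\max\{|\lambda_2(\mathbf{W})|,|\lambda_M(\mathbf{W})|\}<1$, where $\lambda_1(\mathbf W)\ge\dots\ge\lambda_M(\mathbf W)$ are the eigenvalues of $\mathbf W$. Node $i$ holds a symmetric positive semidefinite local covariance matrix $\mathbf{C}_i\in\mathbb{R}^{d\times d}$. The global covariance matrix is $\mathbf{C}=\sum_{i=1}^M\mathbf{C}_i$, with orthonormal eigenvectors $\mathbf{q}_1,\dots,\mathbf{q}_d$ and eigenvalues $\lambda_1>\lambda_2>\dots>\lambda_K>\lambda_{K+1}\ge\dots\ge\lambda_d\ge 0$, where $K\le d$ and $\lambda_K>0$. DSA stands for Distributed Sanger's Algorithm. $\|\cdot\|$ is the Euclidean norm. The data $\mathbf{C}_i$, $\mathbf{W}$, $K$ and the initial vector are fixed; only $\alpha$ varies when a constant is said to be independent of $\alpha$. *)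

theory Defs
  imports "HOL-Analysis.Analysis"
begin

text \<open>
  Nodes are the elements of a finite type; a graph on them is its adjacency relation.
\<close>

definition connected_graph :: "('m \<Rightarrow> 'm \<Rightarrow> bool) \<Rightarrow> bool" where
  "connected_graph E \<longleftrightarrow> irreflp E \<and> symp E \<and> (\<forall>i j. E\<^sup>*\<^sup>* i j)"

definition neighbors :: "('m \<Rightarrow> 'm \<Rightarrow> bool) \<Rightarrow> 'm \<Rightarrow> 'm set" where
  "neighbors E i = {j. E i j}"

definition symmetric_matrix :: "real ^ 'n ^ 'n \<Rightarrow> bool" where
  "symmetric_matrix A \<longleftrightarrow> transpose A = A"

definition psd_matrix :: "real ^ 'n ^ 'n \<Rightarrow> bool" where
  "psd_matrix A \<longleftrightarrow> symmetric_matrix A \<and> (\<forall>v. 0 \<le> v \<bullet> (A *v v))"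

definition doubly_stochastic :: "real ^ 'n ^ 'n \<Rightarrow> bool" where
  "doubly_stochastic A \<longleftrightarrow>
     (\<forall>i j. 0 \<le> A $ i $ j) \<and> (\<forall>i. (\<Sum>j\<in>UNIV. A $ i $ j) = 1) \<and> (\<forall>j. (\<Sum>i\<in>UNIV. A $ i $ j) = 1)"

definition mixing_matrix :: "('m \<Rightarrow> 'm \<Rightarrow> bool) \<Rightarrow> real ^ 'm ^ 'm \<Rightarrow> bool" where
  "mixing_matrix E W \<longleftrightarrow> symmetric_matrix W \<and> doubly_stochastic W \<and>
     (\<forall>i j. i \<noteq> j \<longrightarrow> (W $ i $ j \<noteq> 0 \<longleftrightarrow> E i j)) \<and> (\<forall>i. W $ i $ i \<noteq> 0)"

definition orthonormal_family :: "nat set \<Rightarrow> (nat \<Rightarrow> 'v::real_inner) \<Rightarrow> bool" where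
  "orthonormal_family I q \<longleftrightarrow> (\<forall>k\<in>I. \<forall>l\<in>I. q k \<bullet> q l = (if k = l then 1 else 0))"

text \<open>
  \<open>sanger_spectrum K n lam\<close> says
  \<open>lam 1 > \<dots> > lam K > lam (K + 1) \<ge> \<dots> \<ge> lam n \<ge> 0\<close> and \<open>lam K > 0\<close>. For \<open>K = n\<close> the
  comparison of \<open>lam K\<close> with \<open>lam (K + 1)\<close> is absent. Only the values at \<open>1, \<dots>, n\<close> matter.
\<close>

definition sanger_spectrum :: "nat \<Rightarrow> nat \<Rightarrow> (nat \<Rightarrow> real) \<Rightarrow> bool" where
  "sanger_spectrum K n lam \<longleftrightarrow> 1 \<le> K \<and> K \<le> n \<and> 0 < lam K \<and> 0 \<le> lam n \<and>
     (\<forall>k. 1 \<le> k \<and> k \<le> K \<and> k < n \<longrightarrow> lam (k + 1) < lam k) \<and>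
     (\<forall>k. K < k \<and> k < n \<longrightarrow> lam (k + 1) \<le> lam k)"

text \<open>
  \<open>dsa E W C \<alpha> x0 t i\<close> is the estimate of the leading eigenvector (the first of the \<open>K\<close>
  vectors tracked by Distributed Sanger's Algorithm) at node \<open>i\<close> after \<open>t\<close> iterations with
  step size \<open>\<alpha>\<close>. Its update does not involve the other \<open>K - 1\<close> vectors.
\<close>

primrec dsa :: "('m::finite \<Rightarrow> 'm \<Rightarrow> bool) \<Rightarrow> real ^ 'm ^ 'm \<Rightarrow> ('m \<Rightarrow> real ^ 'd ^ 'd) \<Rightarrow> real
    \<Rightarrow> ('m \<Rightarrow> real ^ 'd) \<Rightarrow> nat \<Rightarrow> 'm \<Rightarrow> real ^ 'd" where
  "dsa E W C \<alpha> x0 0 = x0"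
| "dsa E W C \<alpha> x0 (Suc t) = (\<lambda>i.
     (\<Sum>j\<in>neighbors E i \<union> {i}. W $ i $ j *\<^sub>R dsa E W C \<alpha> x0 t j)
     + \<alpha> *\<^sub>R (C i *v dsa E W C \<alpha> x0 t i
         - (dsa E W C \<alpha> x0 t i \<bullet> (C i *v dsa E W C \<alpha> x0 t i)) *\<^sub>R dsa E W C \<alpha> x0 t i))"

end

theory Submission
  imports Defs
begin

text \<open>
  Since \<open>A\<close> may depend on \<open>\<alpha>\<close>, it is enough that the iterates are bounded and that
  they eventually stay within \<open>B * \<alpha>\<close> of the limit; the step size bound makes the ball of
  radius \<open>sqrt 3\<close> invariant, which settles all \<open>\<alpha>\<close> that are not small. For small \<open>\<alpha>\<close>
  the mixing matrix contracts the disagreement of the nodes, which is therefore \<open>O(\<alpha>)\<close>, so the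
  node average follows Oja's iteration for the global covariance with step
  \<open>\<eta> = \<alpha> / M\<close> up to an error \<open>O(\<eta>\<^sup>2)\<close> per step. For this perturbed iteration
  the norm stays within \<open>O(\<eta>)\<close> of \<open>1\<close>, hence the component along \<open>q 1\<close> stays away
  from \<open>0\<close> and rises to \<open>1 - O(\<eta>)\<close>; from then on the orthogonal component contracts by
  a factor \<open>1 - \<eta> * \<gamma> / 4\<close>, where \<open>\<gamma>\<close> is the spectral gap.
\<close>

section \<open>Oja's vector field for a positive semidefinite operator\<close>

text \<open>At a unit vector this is the projection of \<open>S x\<close> onto the tangent space of
  the sphere, hence for self-adjoint \<open>S\<close> half the gradient of the Rayleigh quotient.
  \<open>S\<close> is a function, so that the local covariances and their sum are treated
  alike.\<close>

definition oja :: "('v::real_inner \<Rightarrow> 'v) \<Rightarrow> 'v \<Rightarrow> 'v" where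
  "oja S x = S x - (x \<bullet> S x) *\<^sub>R x"

text \<open>\<open>l\<close> only bounds the Rayleigh quotient and need not be an eigenvalue: the
  top eigenvalue of the global covariance serves for every local one as well.\<close>

locale psd_operator =
  fixes S :: "'v::real_inner \<Rightarrow> 'v" and l :: real
  assumes lin: "linear S"
    and selfadj: "x \<bullet> S y = S x \<bullet> y"
    and nonneg: "0 \<le> x \<bullet> S x"
    and upper: "x \<bullet> S x \<le> l * (x \<bullet> x)"
    and l_pos: "0 < l"
begin

text \<open>The operator inequality \<open>S^2 <= l S\<close> without diagonalization: expand
  nonnegativity of \<open>S\<close> at \<open>l x - S x\<close>, bound the term cubic in
  \<open>S\<close> by \<open>upper\<close> at \<open>S x\<close>, and divide by
  \<open>l\<close>.\<close>

lemma norm_image_sq_le: "S x \<bullet> S x \<le> l * (x \<bullet> S x)"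
proof -
  let ?y = "l *\<^sub>R x - S x"
  have "?y \<bullet> S ?y = l\<^sup>2 * (x \<bullet> S x) - 2 * l * (S x \<bullet> S x) + S x \<bullet> S (S x)"
    using selfadj[of x "S x"] inner_commute[of "S x" x]
    by (simp add: linear_diff[OF lin] linear_scale[OF lin] inner_simps power2_eq_square
        algebra_simps)
  moreover have "0 \<le> ?y \<bullet> S ?y" by (rule nonneg)
  ultimately have "0 \<le> l * (l * (x \<bullet> S x) - S x \<bullet> S x)"
    using upper[of "S x"] by (simp add: power2_eq_square algebra_simps)
  then show ?thesis using l_pos by (simp add: zero_le_mult_iff)
qed

lemma norm_image_le: "norm (S x) \<le> l * norm x"
proof -
  have "(norm (S x))\<^sup>2 \<le> l * (l * (x \<bullet> x))"
    using norm_image_sq_le[of x] upper[of x] l_pos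
    by (simp add: power2_norm_eq_inner) (smt (verit) mult_left_mono)
  also have "\<dots> = (l * norm x)\<^sup>2"
    by (simp add: power_mult_distrib power2_norm_eq_inner) (simp add: power2_eq_square)
  finally show ?thesis using l_pos by (auto intro: power2_le_imp_le[of _ "l * norm x"])
qed

text \<open>In the cubic term the three occurrences of the argument are changed one at a time. Each
  change costs \<open>r^2 * l\<close>, and the linear term costs \<open>l\<close>.\<close>

lemma oja_lipschitz:
  assumes "norm x \<le> r" "norm y \<le> r"
  shows "norm (oja S x - oja S y) \<le> (1 + 3 * r\<^sup>2) * l * norm (x - y)"
proof -
  have r: "0 \<le> r" using assms(1) norm_ge_zero order_trans by blast
  let ?d = "x - y"
  have Sd: "S x - S y = S ?d" by (simp add: linear_diff[OF lin])
  have eq: "oja S x - oja S y = S ?d - (x \<bullet> S x) *\<^sub>R ?d - (?d \<bullet> S x + y \<bullet> S ?d) *\<^sub>R y"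
    by (simp add: oja_def linear_diff[OF lin] inner_simps algebra_simps)
  have 1: "norm (S ?d) \<le> l * norm ?d" by (rule norm_image_le)
  have Sx: "norm (S x) \<le> l * r"
    using norm_image_le[of x] assms(1) l_pos by (smt (verit) mult_left_mono)
  have "\<bar>x \<bullet> S x\<bar> \<le> norm x * norm (S x)" by (rule Cauchy_Schwarz_ineq2)
  also have "\<dots> \<le> r * (l * r)" using assms Sx r by (intro mult_mono) auto
  finally have 2: "norm ((x \<bullet> S x) *\<^sub>R ?d) \<le> r * (l * r) * norm ?d"
    by (simp add: mult_right_mono)
  have "\<bar>?d \<bullet> S x\<bar> \<le> norm ?d * norm (S x)" by (rule Cauchy_Schwarz_ineq2)
  also have "\<dots> \<le> norm ?d * (l * r)" using Sx by (intro mult_left_mono) auto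
  finally have 3: "\<bar>?d \<bullet> S x\<bar> \<le> norm ?d * (l * r)" .
  have "\<bar>y \<bullet> S ?d\<bar> \<le> norm y * norm (S ?d)" by (rule Cauchy_Schwarz_ineq2)
  also have "\<dots> \<le> r * (l * norm ?d)" using assms 1 r by (intro mult_mono) auto
  finally have 4: "\<bar>?d \<bullet> S x + y \<bullet> S ?d\<bar> \<le> 2 * (norm ?d * (l * r))"
    using 3 by (simp add: algebra_simps)
  have "norm ((?d \<bullet> S x + y \<bullet> S ?d) *\<^sub>R y) \<le> (2 * (norm ?d * (l * r))) * r"
    unfolding norm_scaleR using 4 assms r l_pos by (intro mult_mono) auto
  with 1 2 have "norm (S ?d - (x \<bullet> S x) *\<^sub>R ?d - (?d \<bullet> S x + y \<bullet> S ?d) *\<^sub>R y)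
      \<le> l * norm ?d + r * (l * r) * norm ?d + (2 * (norm ?d * (l * r))) * r"
    by (smt (verit) norm_triangle_ineq4)
  then show ?thesis unfolding eq by (simp add: power2_eq_square algebra_simps)
qed

lemma oja_norm_le:
  assumes "norm x \<le> r"
  shows "norm (oja S x) \<le> (1 + 3 * r\<^sup>2) * l * r"
proof -
  have r: "0 \<le> r" using assms(1) norm_ge_zero order_trans by blast
  have "norm (oja S x) \<le> (1 + 3 * r\<^sup>2) * l * norm x"
    using oja_lipschitz[OF assms, of 0] r by (simp add: oja_def linear_0[OF lin])
  also have "\<dots> \<le> (1 + 3 * r\<^sup>2) * l * r"
    using assms l_pos by (intro mult_left_mono) auto
  finally show ?thesis .
qed

text \<open>\<open>w\<close> is a node's weight on itself. The bound \<open>w * sqrt 3\<close> is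
  the node's share in a convex combination, so the other nodes can add theirs. With \<open>s\<close>
  the squared norm and \<open>p\<close> in \<open>[0, s / 3]\<close> the scaled Rayleigh term, the
  claim reduces to a polynomial inequality in \<open>s\<close> and \<open>p\<close>.\<close>

lemma oja_step_bounded:
  assumes w: "0 < w" and a: "0 \<le> \<alpha>" "\<alpha> * l \<le> w / 3" and x: "norm x \<le> sqrt 3"
  shows "norm (w *\<^sub>R x + \<alpha> *\<^sub>R oja S x) \<le> w * sqrt 3"
proof -
  define s where "s = x \<bullet> x"
  define p where "p = \<alpha> * (x \<bullet> S x) / w"
  have s: "0 \<le> s" "s \<le> 3"
    using x by (simp_all add: s_def norm_eq_sqrt_inner)
  have p0: "0 \<le> p" using w a nonneg by (simp add: p_def)
  have "\<alpha> * (x \<bullet> S x) \<le> \<alpha> * (l * s)"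
    using upper a by (simp add: s_def mult_left_mono)
  also have "\<dots> \<le> w / 3 * s" using a s by (simp add: mult.assoc[symmetric] mult_right_mono del: times_divide_eq_left)
  finally have p1: "p \<le> s / 3" using w by (simp add: p_def field_simps)
  have wp: "\<alpha> * (x \<bullet> S x) = w * p" using w by (simp add: p_def)
  have "\<alpha>\<^sup>2 * (S x \<bullet> S x) \<le> \<alpha>\<^sup>2 * (l * (x \<bullet> S x))"
    by (intro mult_left_mono norm_image_sq_le) simp
  also have "\<dots> = (\<alpha> * l) * (w * p)" by (simp add: wp[symmetric] power2_eq_square)
  also have "\<dots> \<le> w / 3 * (w * p)" using a w p0 by (intro mult_right_mono) auto
  finally have n: "\<alpha>\<^sup>2 * (S x \<bullet> S x) \<le> w\<^sup>2 * (p / 3)" by (simp add: power2_eq_square)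
  have "(norm (w *\<^sub>R x + \<alpha> *\<^sub>R oja S x))\<^sup>2
      = w\<^sup>2 * s + 2 * w * (\<alpha> * (x \<bullet> S x)) * (1 - s) + \<alpha>\<^sup>2 * (S x \<bullet> S x)
        + (\<alpha> * (x \<bullet> S x))\<^sup>2 * (s - 2)"
    unfolding power2_norm_eq_inner oja_def s_def
    using inner_commute[of "S x" x] by (simp add: inner_simps power2_eq_square algebra_simps)
  also have "\<dots> \<le> w\<^sup>2 * (s + 2 * p * (1 - s) + p / 3 + p\<^sup>2 * (s - 2))"
    using n by (simp add: wp power2_eq_square algebra_simps)
  also have "s + 2 * p * (1 - s) + p / 3 + p\<^sup>2 * (s - 2) \<le> 3"
  proof -
    have e: "s + 2 * p * (1 - s) + p / 3 + p\<^sup>2 * (s - 2)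
        = s + p * (2 * (1 - s) + 1 / 3 + p * (s - 2))"
      by (simp add: power2_eq_square algebra_simps)
    \<comment> \<open>The threshold \<open>7 / 6\<close> is the zero of
      \<open>2 * (1 - s) + 1 / 3\<close>. Below it the increment is at most
      \<open>7 / 3 * p\<close>, and \<open>s\<close> is small enough to afford that; above it the
      increment is not positive.\<close>
    show ?thesis
    proof (cases "s \<le> 7 / 6")
      case True
      have "p * (s - 2) \<le> 0" using p0 True by (simp add: mult_nonneg_nonpos)
      then have "p * (2 * (1 - s) + 1 / 3 + p * (s - 2)) \<le> p * (7 / 3)"
        using s p0 by (intro mult_left_mono) auto
      then show ?thesis unfolding e using p1 True by linarith
    next
      case False
      have "p * (s - 2) \<le> max 0 (s - 2)"
      proof (cases "s \<le> 2")
        case True then show ?thesis using p0 by (simp add: mult_nonneg_nonpos)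
      next
        case False
        then have "p * (s - 2) \<le> 1 * (s - 2)" using p1 s by (intro mult_right_mono) auto
        then show ?thesis by simp
      qed
      then have "2 * (1 - s) + 1 / 3 + p * (s - 2) \<le> 0" using False s by (auto simp: max_def split: if_splits)
      then have "p * (2 * (1 - s) + 1 / 3 + p * (s - 2)) \<le> 0" using p0 by (simp add: mult_nonneg_nonpos)
      then show ?thesis unfolding e using s by linarith
    qed
  qed
  finally have "(norm (w *\<^sub>R x + \<alpha> *\<^sub>R oja S x))\<^sup>2 \<le> (w * sqrt 3)\<^sup>2"
    using w by (simp add: power_mult_distrib)
  then show ?thesis using w by (auto intro: power2_le_imp_le[of _ "w * sqrt 3"])
qed

end

section \<open>Affine recursions and small step sizes\<close>

lemma contraction_le:
  fixes y :: "nat \<Rightarrow> real"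
  assumes "0 < r" "r \<le> 1" "\<And>t. y (Suc t) \<le> (1 - r) * y t + b"
  shows "y t \<le> (1 - r) ^ t * (y 0 - b / r) + b / r"
proof (induction t)
  case (Suc t)
  have "y (Suc t) \<le> (1 - r) * y t + b" by (rule assms)
  also have "\<dots> \<le> (1 - r) * ((1 - r) ^ t * (y 0 - b / r) + b / r) + b"
    using Suc assms by (simp add: mult_left_mono)
  also have "\<dots> = (1 - r) ^ Suc t * (y 0 - b / r) + b / r"
    using assms by (simp add: field_simps)
  finally show ?case .
qed simp

text \<open>Iterates end up near the fixed point \<open>b / r\<close> even if the recursion only
  sets in at some time. The slack \<epsilon> absorbs the geometric transient; it is later taken to
  be the step size itself.\<close>

lemma eventually_contraction_le:
  fixes y :: "nat \<Rightarrow> real"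
  assumes "0 < r" "r \<le> 1" "\<forall>\<^sub>F t in sequentially. y (Suc t) \<le> (1 - r) * y t + b" "0 < \<epsilon>"
  shows "\<forall>\<^sub>F t in sequentially. y t \<le> b / r + \<epsilon>"
proof -
  from assms(3) obtain N where N: "\<And>t. t \<ge> N \<Longrightarrow> y (Suc t) \<le> (1 - r) * y t + b"
    by (auto simp: eventually_sequentially)
  define w where "w t = y (t + N)" for t
  have w: "w t \<le> (1 - r) ^ t * (w 0 - b / r) + b / r" for t
    using assms N by (intro contraction_le) (auto simp: w_def)
  have "(\<lambda>t. (1 - r) ^ t * (w 0 - b / r)) \<longlonglongrightarrow> 0"
    using assms by (intro tendsto_mult_left_zero LIMSEQ_power_zero) auto
  then have "\<forall>\<^sub>F t in sequentially. (1 - r) ^ t * (w 0 - b / r) < \<epsilon>"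
    using assms(4) by (rule order_tendstoD)
  then have "\<forall>\<^sub>F t in sequentially. w t \<le> b / r + \<epsilon>"
    by eventually_elim (use w in \<open>smt (verit)\<close>)
  then show ?thesis unfolding w_def
    by (rule eventually_sequentially_seg[THEN iffD1])
qed

lemma eventually_at_right_mult_le:
  fixes K m :: real
  assumes "0 < m"
  shows "\<forall>\<^sub>F x in at_right 0. K * x \<le> m"
proof -
  have "((\<lambda>x. K * x) \<longlongrightarrow> K * 0) (at_right 0)" by (intro tendsto_intros)
  then have "\<forall>\<^sub>F x in at_right 0. K * x < m" using assms by (intro order_tendstoD) auto
  then show ?thesis by eventually_elim simp
qed

section \<open>The perturbed Oja iteration under a spectral gap\<close>

text \<open>Here \<open>l\<close> is attained at the unit vector \<open>p\<close>, and the rest of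
  the spectrum lies at least \<gamma> below it. \<open>p\<close> stands for either sign of the
  leading eigenvector.\<close>

locale oja_gap = psd_operator S l for S :: "'v::real_inner \<Rightarrow> 'v" and l :: real +
  fixes p :: 'v and \<gamma> :: real
  assumes p_unit: "p \<bullet> p = 1"
    and p_eigen: "S p = l *\<^sub>R p"
    and gap: "p \<bullet> u = 0 \<Longrightarrow> u \<bullet> S u \<le> (l - \<gamma>) * (u \<bullet> u)"
    and gap_pos: "0 < \<gamma>" and gap_le: "\<gamma> \<le> l"
begin

abbreviation orth :: "'v \<Rightarrow> 'v" where
  "orth z \<equiv> z - (p \<bullet> z) *\<^sub>R p"

lemma inner_p_orth [simp]: "p \<bullet> orth z = 0"
  by (simp add: inner_simps p_unit)

lemma inner_p_image: "p \<bullet> S z = l * (p \<bullet> z)"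
  by (simp add: selfadj p_eigen)

lemma orth_norm_sq: "orth z \<bullet> orth z = z \<bullet> z - (p \<bullet> z)\<^sup>2"
  using inner_commute[of z p] by (simp add: inner_simps p_unit power2_eq_square)

lemma orth_norm_le: "norm (orth z) \<le> norm z"
  using orth_norm_sq[of z] by (simp add: norm_le)

lemma rayleigh_decomp: "z \<bullet> S z = l * (p \<bullet> z)\<^sup>2 + orth z \<bullet> S (orth z)"
  using inner_p_image[of z] inner_commute[of z p]
  by (simp add: linear_diff[OF lin] linear_scale[OF lin] p_eigen inner_simps p_unit
      power2_eq_square algebra_simps)

lemma rayleigh_ge: "l * (p \<bullet> z)\<^sup>2 \<le> z \<bullet> S z"
  using rayleigh_decomp[of z] nonneg[of "orth z"] by simp

lemma rayleigh_le: "z \<bullet> S z \<le> l * (p \<bullet> z)\<^sup>2 + (l - \<gamma>) * (z \<bullet> z - (p \<bullet> z)\<^sup>2)"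
  using rayleigh_decomp[of z] gap[of "orth z"] by (simp add: orth_norm_sq del: inner_diff_left inner_diff_right)

lemma orth_oja_step:
  "orth (z + \<eta> *\<^sub>R oja S z) = orth z + \<eta> *\<^sub>R (S (orth z) - (z \<bullet> S z) *\<^sub>R orth z)"
  by (simp add: oja_def inner_simps linear_diff[OF lin] linear_scale[OF lin] p_eigen inner_p_image
      algebra_simps)

text \<open>To first order the squared norm changes by twice \<open>z \<bullet> oja S z = (z
  \<bullet> S z) * (1 - z \<bullet> z)\<close>, which pulls it towards 1. What remains is the
  perturbation paired with \<open>z\<close> and the squared increment. The constant 26 is
  \<open>(1 + 3 * r^2) * r\<close> at \<open>r = 2\<close>.\<close>

lemma step_norm_sq:
  assumes \<eta>: "0 < \<eta>" "\<eta> \<le> 1" and c: "0 \<le> c" and z: "norm z \<le> 2"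
    and step: "norm (z' - (z + \<eta> *\<^sub>R oja S z)) \<le> c * \<eta>\<^sup>2"
  shows "\<bar>z' \<bullet> z' - (z \<bullet> z + 2 * \<eta> * (z \<bullet> S z) * (1 - z \<bullet> z))\<bar> \<le> (4 * c + (26 * l + c)\<^sup>2) * \<eta>\<^sup>2"
proof -
  define e where "e = z' - (z + \<eta> *\<^sub>R oja S z)"
  define f where "f = \<eta> *\<^sub>R oja S z + e"
  have z': "z' = z + f" by (simp add: e_def f_def)
  have e: "norm e \<le> c * \<eta>\<^sup>2" using step by (simp add: e_def)
  have sq: "\<eta>\<^sup>2 \<le> \<eta>" using \<eta> by (simp add: power2_eq_square mult_left_le)
  have o: "norm (oja S z) \<le> 26 * l" using oja_norm_le[OF z] by simp
  have "norm f \<le> norm (\<eta> *\<^sub>R oja S z) + norm e" unfolding f_def by (rule norm_triangle_ineq)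
  also have "norm (\<eta> *\<^sub>R oja S z) \<le> \<eta> * (26 * l)" using o \<eta> by (simp add: mult_left_mono)
  also have "norm e \<le> c * \<eta>" using e sq c by (meson mult_left_mono order_trans)
  finally have f: "norm f \<le> (26 * l + c) * \<eta>" by (simp add: algebra_simps)
  have ff: "\<bar>f \<bullet> f\<bar> \<le> (26 * l + c)\<^sup>2 * \<eta>\<^sup>2"
    using power_mono[OF f, of 2] by (simp add: power_mult_distrib power2_norm_eq_inner)
  have "\<bar>z \<bullet> e\<bar> \<le> norm z * norm e" by (rule Cauchy_Schwarz_ineq2)
  also have "\<dots> \<le> 2 * (c * \<eta>\<^sup>2)" using z e by (intro mult_mono) auto
  finally have ze: "\<bar>z \<bullet> e\<bar> \<le> 2 * (c * \<eta>\<^sup>2)" .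
  have zo: "z \<bullet> oja S z = (z \<bullet> S z) * (1 - z \<bullet> z)" by (simp add: oja_def inner_simps algebra_simps)
  have "z' \<bullet> z' = z \<bullet> z + 2 * (z \<bullet> f) + f \<bullet> f"
    unfolding z' using inner_commute[of z f] by (simp add: inner_simps)
  also have "z \<bullet> f = \<eta> * ((z \<bullet> S z) * (1 - z \<bullet> z)) + z \<bullet> e"
    by (simp add: f_def inner_simps zo)
  finally have "z' \<bullet> z' - (z \<bullet> z + 2 * \<eta> * (z \<bullet> S z) * (1 - z \<bullet> z)) = 2 * (z \<bullet> e) + f \<bullet> f"
    by (simp add: algebra_simps)
  then show ?thesis using ff ze unfolding distrib_right by linarith
qed

lemma step_coord:
  assumes step: "norm (z' - (z + \<eta> *\<^sub>R oja S z)) \<le> b"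
  shows "\<bar>p \<bullet> z' - (p \<bullet> z + \<eta> * (l - z \<bullet> S z) * (p \<bullet> z))\<bar> \<le> b"
proof -
  define e where "e = z' - (z + \<eta> *\<^sub>R oja S z)"
  have z': "z' = z + \<eta> *\<^sub>R oja S z + e" by (simp add: e_def)
  have "p \<bullet> z' - (p \<bullet> z + \<eta> * (l - z \<bullet> S z) * (p \<bullet> z)) = p \<bullet> e"
    unfolding z' oja_def by (simp add: inner_simps inner_p_image algebra_simps)
  also have "\<bar>p \<bullet> e\<bar> \<le> norm p * norm e" by (rule Cauchy_Schwarz_ineq2)
  finally show ?thesis using step p_unit by (simp add: e_def norm_eq_sqrt_inner)
qed

text \<open>Off \<open>p\<close> the operator is at most \<open>l - \<gamma>\<close>, while the
  subtracted Rayleigh quotient is at least \<open>l - \<gamma> / 2\<close>, so the orthogonal part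
  shrinks at rate \<open>\<gamma> / 2\<close>. Half of the resulting decrease of its square pays for
  the second-order term.\<close>

lemma step_orth:
  assumes \<eta>: "0 < \<eta>" "\<eta> * \<gamma> \<le> 1" "18 * l\<^sup>2 * \<eta> \<le> \<gamma>"
    and r: "l - \<gamma> / 2 \<le> z \<bullet> S z" "z \<bullet> S z \<le> 2 * l"
    and step: "norm (z' - (z + \<eta> *\<^sub>R oja S z)) \<le> b"
  shows "norm (orth z') \<le> (1 - \<eta> * \<gamma> / 4) * norm (orth z) + b"
proof -
  define e where "e = z' - (z + \<eta> *\<^sub>R oja S z)"
  define u where "u = orth z"
  define v where "v = S u - (z \<bullet> S z) *\<^sub>R u"
  have z': "z' = (z + \<eta> *\<^sub>R oja S z) + e" by (simp add: e_def)
  have o: "orth z' = (u + \<eta> *\<^sub>R v) + orth e"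
    unfolding u_def v_def orth_oja_step[symmetric] z' by (simp add: inner_simps algebra_simps)
  have "norm v \<le> norm (S u) + norm ((z \<bullet> S z) *\<^sub>R u)"
    unfolding v_def by (rule norm_triangle_ineq4)
  also have "\<dots> \<le> l * norm u + 2 * l * norm u"
    using norm_image_le[of u] mult_right_mono[OF r(2), of "norm u"] nonneg[of z] by simp
  finally have "norm v \<le> 3 * l * norm u" by simp
  then have vv: "v \<bullet> v \<le> 9 * l\<^sup>2 * (u \<bullet> u)"
    using power_mono[of "norm v" "3 * l * norm u" 2] by (simp add: power_mult_distrib power2_norm_eq_inner)
  have "u \<bullet> v \<le> (l - \<gamma>) * (u \<bullet> u) - (z \<bullet> S z) * (u \<bullet> u)"
    using gap[of u] unfolding v_def u_def inner_diff_right[of _ "S _"] by simp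
  also have "\<dots> \<le> - \<gamma> / 2 * (u \<bullet> u)"
    using mult_right_mono[of "l - \<gamma> - z \<bullet> S z" "- \<gamma> / 2" "u \<bullet> u"] r by (simp add: algebra_simps)
  finally have uv: "u \<bullet> v \<le> - \<gamma> / 2 * (u \<bullet> u)" .
  have "(norm (u + \<eta> *\<^sub>R v))\<^sup>2 = u \<bullet> u + 2 * \<eta> * (u \<bullet> v) + \<eta> * (\<eta> * (v \<bullet> v))"
    using inner_commute[of u v] by (simp add: power2_norm_eq_inner inner_simps algebra_simps)
  also have "\<dots> \<le> u \<bullet> u + 2 * \<eta> * (- \<gamma> / 2 * (u \<bullet> u)) + \<eta> * (\<eta> * (9 * l\<^sup>2 * (u \<bullet> u)))"
    using \<eta> uv vv by (intro add_mono mult_left_mono) auto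
  also have "\<eta> * (9 * l\<^sup>2 * (u \<bullet> u)) \<le> \<gamma> / 2 * (u \<bullet> u)"
    using mult_right_mono[OF \<eta>(3), of "u \<bullet> u"] by (simp add: algebra_simps)
  finally have "(norm (u + \<eta> *\<^sub>R v))\<^sup>2 \<le> (1 - \<eta> * \<gamma> / 2) * (u \<bullet> u)"
    using \<eta> by (simp add: algebra_simps)
  also have "\<dots> \<le> (1 - \<eta> * \<gamma> / 4)\<^sup>2 * (u \<bullet> u)"
    using zero_le_square[of "\<eta> * \<gamma>"]
    by (intro mult_right_mono) (simp_all add: power2_eq_square algebra_simps)
  also have "\<dots> = ((1 - \<eta> * \<gamma> / 4) * norm u)\<^sup>2"
    by (simp add: power_mult_distrib power2_norm_eq_inner)
  finally have "norm (u + \<eta> *\<^sub>R v) \<le> (1 - \<eta> * \<gamma> / 4) * norm u"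
    by (rule power2_le_imp_le) (use \<eta> in simp)
  moreover have "norm (orth e) \<le> b" using orth_norm_le[of e] step by (simp add: e_def)
  ultimately show ?thesis unfolding o u_def[symmetric] by (meson add_mono norm_triangle_le)
qed


text \<open>
  The values of \<open>\<kappa>\<close> and \<open>\<delta>\<close> balance the per-step errors of \<open>z \<bullet> z\<close> and
  \<open>p \<bullet> z\<close>, using \<open>l * a0\<^sup>2 / 4 \<le> z \<bullet> S z\<close> for the contraction of \<open>1 - z \<bullet> z\<close>.
\<close>

lemma step_invariant:
  assumes a0: "0 < a0" "a0 \<le> 1" and c: "0 \<le> c"
    and kap: "\<kappa> * (l * a0\<^sup>2 / 2) = 4 * c + (26 * l + c)\<^sup>2"
    and dr: "\<delta> = 2 * l * \<kappa> + c"
    and \<eta>: "0 < \<eta>" "\<eta> \<le> 1" "\<kappa> * \<eta> \<le> 1" "4 * l * \<eta> \<le> 1" "\<delta> * \<eta> \<le> \<gamma> * a0 / 5"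
      "(6 * \<gamma> + \<delta>) * \<eta> \<le> 1 / 4"
    and inv: "\<bar>1 - z \<bullet> z\<bar> \<le> \<kappa> * \<eta>" "a0 / 2 \<le> p \<bullet> z"
    and step: "norm (z' - (z + \<eta> *\<^sub>R oja S z)) \<le> c * \<eta>\<^sup>2"
  shows "\<bar>1 - z' \<bullet> z'\<bar> \<le> \<kappa> * \<eta>"
    and "a0 / 2 \<le> p \<bullet> z'"
    and "p \<bullet> z + \<eta> * (\<gamma> * (p \<bullet> z) * (1 - (p \<bullet> z)\<^sup>2)) - \<delta> * \<eta>\<^sup>2 \<le> p \<bullet> z'"
    and "z \<bullet> S z \<le> 2 * l"
    and "p \<bullet> z \<le> 1 + \<kappa> * \<eta>"
    and "p \<bullet> z \<le> 3 / 2"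
proof -
  define a where "a = p \<bullet> z"
  define s where "s = z \<bullet> z"
  define \<rho> where "\<rho> = z \<bullet> S z"
  define c1 where "c1 = 4 * c + (26 * l + c)\<^sup>2"
  have s2: "s \<le> 2" using inv \<eta> by (simp add: s_def)
  have as: "a\<^sup>2 \<le> s" using orth_norm_sq[of z] inner_ge_zero[of "orth z"] unfolding a_def s_def by linarith
  have a_ge: "a0 / 2 \<le> a" using inv by (simp add: a_def)
  have a: "a \<le> 3 / 2"
  proof (rule ccontr)
    assume "\<not> a \<le> 3 / 2"
    then have "(3 / 2)\<^sup>2 < a\<^sup>2" by (intro power_strict_mono) auto
    then show False using as s2 by (simp add: power2_eq_square)
  qed
  have kpos: "0 \<le> \<kappa> * \<eta>" using inv(1) by linarith
  have kpos': "0 \<le> \<kappa>" using kpos \<eta> by (simp add: zero_le_mult_iff)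
  show "p \<bullet> z \<le> 3 / 2" using a by (simp add: a_def)
  have "a\<^sup>2 \<le> (1 + \<kappa> * \<eta>)\<^sup>2"
    using as inv kpos mult_nonneg_nonneg[OF kpos kpos]
    by (simp add: s_def power2_eq_square algebra_simps abs_le_iff)
  then show "p \<bullet> z \<le> 1 + \<kappa> * \<eta>"
    unfolding a_def by (rule power2_le_imp_le) (use kpos in simp)
  have \<rho>_ge: "l * a0\<^sup>2 / 4 \<le> \<rho>"
  proof -
    have "(a0 / 2)\<^sup>2 \<le> a\<^sup>2" using a_ge a0 by (intro power_mono) auto
    then have "l * (a0 / 2)\<^sup>2 \<le> l * a\<^sup>2" using l_pos by (intro mult_left_mono) auto
    then show ?thesis using rayleigh_ge[of z] by (simp add: \<rho>_def a_def power_divide)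
  qed
  have "l * s \<le> l * 2" using s2 l_pos by (intro mult_left_mono) auto
  then have \<rho>_le: "\<rho> \<le> 2 * l" using upper[of z] by (simp add: \<rho>_def s_def)
  then show "z \<bullet> S z \<le> 2 * l" by (simp add: \<rho>_def)
  have nz: "norm z \<le> 2"
    by (rule power2_le_imp_le) (use s2 in \<open>simp_all add: power2_norm_eq_inner s_def\<close>)
  have \<eta>\<rho>: "2 * \<eta> * \<rho> \<le> 1"
  proof -
    have "2 * \<eta> * \<rho> \<le> 2 * \<eta> * (2 * l)" using \<rho>_le \<eta>(1) by (intro mult_left_mono) auto
    also have "\<dots> = 4 * l * \<eta>" by simp
    also have "\<dots> \<le> 1" by (rule \<eta>(4))
    finally show ?thesis .
  qed
  have \<eta>\<rho>_ge: "2 * \<eta> * (l * a0\<^sup>2 / 4) \<le> 2 * \<eta> * \<rho>"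
    using \<rho>_ge \<eta>(1) by (intro mult_left_mono) auto
  have "\<bar>z' \<bullet> z' - (s + 2 * \<eta> * \<rho> * (1 - s))\<bar> \<le> c1 * \<eta>\<^sup>2"
    using step_norm_sq[OF \<eta>(1,2) c nz step] by (simp add: s_def \<rho>_def c1_def)
  then have "\<bar>1 - z' \<bullet> z'\<bar> \<le> \<bar>(1 - 2 * \<eta> * \<rho>) * (1 - s)\<bar> + c1 * \<eta>\<^sup>2"
    by (simp add: algebra_simps)
  also have "\<bar>(1 - 2 * \<eta> * \<rho>) * (1 - s)\<bar> \<le> (1 - 2 * \<eta> * (l * a0\<^sup>2 / 4)) * (\<kappa> * \<eta>)"
    unfolding abs_mult
    by (rule mult_mono) (use \<eta>\<rho> \<eta>\<rho>_ge inv(1) in \<open>(linarith | simp add: s_def)+\<close>)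
  also have "\<dots> + c1 * \<eta>\<^sup>2 = \<kappa> * \<eta>"
    unfolding c1_def kap[symmetric] by (simp add: power2_eq_square algebra_simps)
  finally show "\<bar>1 - z' \<bullet> z'\<bar> \<le> \<kappa> * \<eta>" by simp

  \<comment> \<open>\<open>l - \<rho>\<close> is the growth rate of \<open>p \<bullet> z\<close>.
    The estimate splits it into a drift towards 1 and a term that is \<open>O(\<eta>)\<close> by the
    bound on \<open>1 - s\<close>.\<close>
  have "\<gamma> * (1 - a\<^sup>2) + (l - \<gamma>) * (1 - s) \<le> l - \<rho>"
    using rayleigh_le[of z] by (simp add: a_def s_def \<rho>_def algebra_simps)
  moreover have "- (l * (\<kappa> * \<eta>)) \<le> (l - \<gamma>) * (1 - s)"
  proof -
    have "\<bar>(l - \<gamma>) * (1 - s)\<bar> \<le> l * (\<kappa> * \<eta>)"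
      unfolding abs_mult using inv gap_pos gap_le l_pos by (intro mult_mono) (auto simp: s_def)
    then show ?thesis by linarith
  qed
  ultimately have "\<gamma> * (1 - a\<^sup>2) - l * (\<kappa> * \<eta>) \<le> l - \<rho>" by linarith
  then have "(\<eta> * a) * (\<gamma> * (1 - a\<^sup>2) - l * (\<kappa> * \<eta>)) \<le> (\<eta> * a) * (l - \<rho>)"
    using \<eta> a_ge a0 by (intro mult_left_mono) auto
  moreover have "a * (\<eta> * (l * (\<kappa> * \<eta>))) \<le> 2 * (\<eta> * (l * (\<kappa> * \<eta>)))"
    using a \<eta> l_pos kpos by (intro mult_right_mono) auto
  moreover have "\<bar>p \<bullet> z' - (a + \<eta> * (l - \<rho>) * a)\<bar> \<le> c * \<eta>\<^sup>2"
    using step_coord[OF step] by (simp add: a_def \<rho>_def)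
  ultimately have low: "a + \<eta> * (\<gamma> * a * (1 - a\<^sup>2)) - \<delta> * \<eta>\<^sup>2 \<le> p \<bullet> z'"
    by (simp add: dr power2_eq_square algebra_simps abs_le_iff)
  then show "p \<bullet> z + \<eta> * (\<gamma> * (p \<bullet> z) * (1 - (p \<bullet> z)\<^sup>2)) - \<delta> * \<eta>\<^sup>2 \<le> p \<bullet> z'"
    by (simp add: a_def)
  show "a0 / 2 \<le> p \<bullet> z'"
  \<comment> \<open>For \<open>a\<close> up to \<open>3 / 4\<close> the drift is at least
    \<open>\<gamma> * a0 / 5\<close> and outweighs the error \<open>\<delta> * \<eta>\<close>, so
    \<open>a\<close> does not decrease. Beyond that, one step loses at most \<open>1 / 4\<close>,
    which leaves \<open>1 / 2 >= a0 / 2\<close>.\<close>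
  proof (cases "a \<le> 3 / 4")
    case True
    have "a\<^sup>2 \<le> (3 / 4)\<^sup>2" using True a_ge a0 by (intro power_mono) auto
    then have "a0 / 2 * (2 / 5) \<le> a * (1 - a\<^sup>2)"
      using a_ge a0 by (intro mult_mono) (auto simp: power2_eq_square)
    then have "\<gamma> * (a0 / 5) \<le> \<gamma> * (a * (1 - a\<^sup>2))"
      using gap_pos by (intro mult_left_mono) auto
    then have "\<delta> * \<eta> \<le> \<gamma> * a * (1 - a\<^sup>2)" using \<eta>(5) by simp
    then have "\<eta> * (\<delta> * \<eta>) \<le> \<eta> * (\<gamma> * a * (1 - a\<^sup>2))" using \<eta> by (intro mult_left_mono) auto
    then show ?thesis using low a_ge by (simp add: power2_eq_square algebra_simps)
  next
    case False
    have "a * (a\<^sup>2 - 1) \<le> a * 1" using as s2 a_ge a0 by (intro mult_left_mono) auto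
    then have "a * (a\<^sup>2 - 1) \<le> 6" using a by simp
    then have "\<eta> * (\<gamma> * (a * (a\<^sup>2 - 1))) \<le> \<eta> * (\<gamma> * 6)"
      using \<eta> gap_pos by (intro mult_left_mono) auto
    moreover have "\<delta> * \<eta>\<^sup>2 \<le> \<delta> * \<eta>"
      using \<eta> c kpos' l_pos by (simp add: dr power2_eq_square mult_left_le_one_le mult_left_le mult_left_mono)
    ultimately show ?thesis using low \<eta>(6) False a0 by (simp add: algebra_simps)
  qed
qed


text \<open>Near-unit norm together with \<open>p \<bullet> z >= 1 - O(\<eta>)\<close> confines the
  orthogonal part only to \<open>O(sqrt \<eta>)\<close>. A second stage therefore contracts that
  part directly, with error \<open>c * \<eta>^2\<close> against rate
  \<open>\<eta> * \<gamma> / 4\<close>, which yields \<open>O(\<eta>)\<close>.\<close>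

lemma perturbed_oja_converges:
  assumes a0: "0 < a0" "a0 \<le> 1" and c: "0 \<le> c"
  shows "\<exists>B>0. \<forall>\<^sub>F \<eta> in at_right 0. \<forall>z. norm (z 0) = 1 \<longrightarrow> a0 \<le> p \<bullet> z 0 \<longrightarrow>
      (\<forall>t. norm (z (Suc t) - (z t + \<eta> *\<^sub>R oja S (z t))) \<le> c * \<eta>\<^sup>2) \<longrightarrow>
      (\<forall>\<^sub>F t in sequentially. norm (z t - p) \<le> B * \<eta>)"
proof -
  define \<kappa> where "\<kappa> = (4 * c + (26 * l + c)\<^sup>2) / (l * a0\<^sup>2 / 2)"
  define \<delta> where "\<delta> = 2 * l * \<kappa> + c"
  define \<mu> where "\<mu> = \<gamma> * a0 / 2"
  define \<nu> where "\<nu> = \<delta> / \<mu> + 1"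
  \<comment> \<open>The first summand bounds the orthogonal part; \<kappa> and \<nu> bound how far
    \<open>p \<bullet> z\<close> lies above and below 1.\<close>
  define B where "B = (4 * c / \<gamma> + 1) + (\<kappa> + \<nu>)"
  have kap: "\<kappa> * (l * a0\<^sup>2 / 2) = 4 * c + (26 * l + c)\<^sup>2"
    using l_pos a0 by (simp add: \<kappa>_def)
  have "0 \<le> \<kappa>" using l_pos c by (simp add: \<kappa>_def)
  moreover from this have "0 \<le> \<delta>" using l_pos c by (simp add: \<delta>_def)
  moreover have "0 < \<mu>" using gap_pos a0 by (simp add: \<mu>_def)
  moreover from calculation have "0 < \<nu>" by (simp add: \<nu>_def add_nonneg_pos)
  moreover from calculation have "0 < B"
    using c gap_pos by (simp add: B_def add_nonneg_pos add_pos_pos)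
  ultimately have pos: "0 \<le> \<kappa>" "0 \<le> \<delta>" "0 < \<mu>" "0 < \<nu>" "0 < B" by auto
  \<comment> \<open>The conditions up to \<open>1 / 4\<close> make one step preserve the invariant;
    the last two are for the contraction of the orthogonal part.\<close>
  have "\<forall>\<^sub>F \<eta> in at_right 0. 0 < \<eta> \<and> \<eta> \<le> 1 \<and> \<kappa> * \<eta> \<le> 1 \<and> 4 * l * \<eta> \<le> 1 \<and> \<delta> * \<eta> \<le> \<gamma> * a0 / 5
      \<and> (6 * \<gamma> + \<delta>) * \<eta> \<le> 1 / 4 \<and> 18 * l\<^sup>2 * \<eta> \<le> \<gamma> \<and> 4 * l * \<nu> * \<eta> \<le> \<gamma>"
    using eventually_at_right_mult_le[of 1 1] gap_pos a0
    by (intro eventually_conj eventually_at_right_mult_le eventually_at_right_less) auto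
  then have "\<forall>\<^sub>F \<eta> in at_right 0. \<forall>z. norm (z 0) = 1 \<longrightarrow> a0 \<le> p \<bullet> z 0 \<longrightarrow>
      (\<forall>t. norm (z (Suc t) - (z t + \<eta> *\<^sub>R oja S (z t))) \<le> c * \<eta>\<^sup>2) \<longrightarrow>
      (\<forall>\<^sub>F t in sequentially. norm (z t - p) \<le> B * \<eta>)"
  proof eventually_elim
    case (elim \<eta>)
    then have \<eta>: "0 < \<eta>" "\<eta> \<le> 1" "\<kappa> * \<eta> \<le> 1" "4 * l * \<eta> \<le> 1" "\<delta> * \<eta> \<le> \<gamma> * a0 / 5"
      "(6 * \<gamma> + \<delta>) * \<eta> \<le> 1 / 4" and \<eta>': "18 * l\<^sup>2 * \<eta> \<le> \<gamma>" "4 * l * \<nu> * \<eta> \<le> \<gamma>" by auto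
    have \<delta>\<eta>: "0 \<le> \<delta> * \<eta>" using pos \<eta> by simp
    have \<gamma>\<eta>: "6 * (\<eta> * \<gamma>) \<le> 1" using \<eta>(6) \<delta>\<eta> by (simp add: algebra_simps)
    show ?case
    proof (intro allI impI)
      fix z :: "nat \<Rightarrow> 'v"
      assume z0: "norm (z 0) = 1" "a0 \<le> p \<bullet> z 0"
        and step: "\<forall>t. norm (z (Suc t) - (z t + \<eta> *\<^sub>R oja S (z t))) \<le> c * \<eta>\<^sup>2"
      note inv_step = step_invariant[OF a0 c kap \<delta>_def \<eta> _ _ step[rule_format]]
      have inv: "\<bar>1 - z t \<bullet> z t\<bar> \<le> \<kappa> * \<eta> \<and> a0 / 2 \<le> p \<bullet> z t" for t
      proof (induction t)
        case 0
        have "z 0 \<bullet> z 0 = 1" using z0 by (simp add: norm_eq_1)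
        then show ?case using z0 pos \<eta> a0 by simp
      next
        case (Suc t)
        then show ?case using inv_step(1,2) by blast
      qed
      \<comment> \<open>The coordinate may overshoot 1. Truncation keeps \<open>y\<close>
        nonnegative, so that the varying factor \<open>1 - m\<close> can be replaced by the uniform
        \<open>1 - \<eta> * \<mu>\<close>.\<close>
      define y where "y t = max 0 (1 - p \<bullet> z t)" for t
      have y: "y (Suc t) \<le> (1 - \<eta> * \<mu>) * y t + \<delta> * \<eta>\<^sup>2" for t
      proof -
        define a where "a = p \<bullet> z t"
        \<comment> \<open>The drift factors through \<open>1 - a^2 = (1 - a) * (1 + a)\<close>, so
          \<open>m\<close> is the rate at which \<open>1 - a\<close> contracts.\<close>
        define m where "m = \<eta> * (\<gamma> * (a * (1 + a)))"
        have a: "a0 / 2 \<le> a" "a \<le> 3 / 2"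
          using inv[of t] inv_step(6)[of t] by (auto simp: a_def)
        have "a * (1 + a) \<le> 3 / 2 * 4" using a a0 by (intro mult_mono) auto
        then have "\<gamma> * (a * (1 + a)) \<le> \<gamma> * 6" using gap_pos by (intro mult_left_mono) auto
        then have "m \<le> \<eta> * (\<gamma> * 6)" unfolding m_def by (rule mult_left_mono) (use \<eta> in simp)
        then have m1: "m \<le> 1" using \<gamma>\<eta> by simp
        have "a0 / 2 * 1 \<le> a * (1 + a)" using a a0 by (intro mult_mono) auto
        then have "\<gamma> * (a0 / 2) \<le> \<gamma> * (a * (1 + a))" using gap_pos by (intro mult_left_mono) auto
        then have "\<eta> * (\<gamma> * (a0 / 2)) \<le> m" unfolding m_def by (rule mult_left_mono) (use \<eta> in simp)
        then have m2: "\<eta> * \<mu> \<le> m" by (simp add: \<mu>_def)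
        have "1 - p \<bullet> z (Suc t) \<le> (1 - m) * (1 - a) + \<delta> * \<eta>\<^sup>2"
          using inv_step(3)[of t] inv[of t]
          by (simp add: a_def m_def power2_eq_square algebra_simps)
        also have "(1 - m) * (1 - a) \<le> (1 - m) * y t"
          using m1 by (intro mult_left_mono) (auto simp: y_def a_def)
        also have "\<dots> \<le> (1 - \<eta> * \<mu>) * y t"
          using m2 by (intro mult_right_mono) (auto simp: y_def)
        finally have "1 - p \<bullet> z (Suc t) \<le> (1 - \<eta> * \<mu>) * y t + \<delta> * \<eta>\<^sup>2" by simp
        moreover have "0 \<le> (1 - \<eta> * \<mu>) * y t + \<delta> * \<eta>\<^sup>2"
          using m1 m2 pos by (auto simp: y_def intro!: add_nonneg_nonneg mult_nonneg_nonneg)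
        ultimately show ?thesis by (simp add: y_def)
      qed
      have "\<eta> * \<mu> \<le> \<eta> * \<gamma>" using a0 gap_pos \<eta> by (auto simp: \<mu>_def intro!: mult_left_mono)
      then have "\<eta> * \<mu> \<le> 1" using \<gamma>\<eta> by linarith
      then have "\<forall>\<^sub>F t in sequentially. y t \<le> \<delta> * \<eta>\<^sup>2 / (\<eta> * \<mu>) + \<eta>"
        using \<eta> pos y by (intro eventually_contraction_le) auto
      also have "\<delta> * \<eta>\<^sup>2 / (\<eta> * \<mu>) + \<eta> = \<nu> * \<eta>"
        using \<eta> by (simp add: \<nu>_def power2_eq_square algebra_simps)
      finally have ev_y: "\<forall>\<^sub>F t in sequentially. 1 - p \<bullet> z t \<le> \<nu> * \<eta>"
        by eventually_elim (simp add: y_def)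
      then have "\<forall>\<^sub>F t in sequentially.
          norm (orth (z (Suc t))) \<le> (1 - \<eta> * \<gamma> / 4) * norm (orth (z t)) + c * \<eta>\<^sup>2"
      proof eventually_elim
        case (elim t)
        \<comment> \<open>From \<open>a^2 >= 2 * a - 1\<close>: the Rayleigh quotient is now within
          \<open>\<gamma> / 2\<close> below \<open>l\<close>, the threshold at which the orthogonal
          part starts to contract.\<close>
        have "1 - 2 * (\<nu> * \<eta>) \<le> (p \<bullet> z t)\<^sup>2"
          using elim zero_le_power2[of "p \<bullet> z t - 1"] by (simp add: power2_eq_square algebra_simps)
        then have "l * (1 - 2 * (\<nu> * \<eta>)) \<le> l * (p \<bullet> z t)\<^sup>2"
          using l_pos by (intro mult_left_mono) auto
        then have "l - \<gamma> / 2 \<le> z t \<bullet> S (z t)"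
          using rayleigh_ge[of "z t"] \<eta>'(2) by (simp add: algebra_simps)
        then show ?case
          using inv_step(4)[of t] inv[of t] \<eta> \<eta>'(1) \<gamma>\<eta> step gap_pos
          by (intro step_orth) auto
      qed
      then have "\<forall>\<^sub>F t in sequentially. norm (orth (z t)) \<le> c * \<eta>\<^sup>2 / (\<eta> * \<gamma> / 4) + \<eta>"
        using \<eta> gap_pos \<gamma>\<eta> by (intro eventually_contraction_le) auto
      also have "c * \<eta>\<^sup>2 / (\<eta> * \<gamma> / 4) + \<eta> = (4 * c / \<gamma> + 1) * \<eta>"
        using \<eta> gap_pos by (simp add: power2_eq_square field_simps)
      finally show "\<forall>\<^sub>F t in sequentially. norm (z t - p) \<le> B * \<eta>"
        using ev_y
      proof eventually_elim
        case (elim t)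
        have "p \<bullet> z t \<le> 1 + \<kappa> * \<eta>" using inv_step(5) inv by blast
        then have "\<bar>p \<bullet> z t - 1\<bar> \<le> \<kappa> * \<eta> + \<nu> * \<eta>"
          using elim pos \<eta> by (simp add: abs_le_iff add_increasing add_increasing2)
        then have "norm ((p \<bullet> z t - 1) *\<^sub>R p) \<le> (\<kappa> + \<nu>) * \<eta>"
          using p_unit[folded norm_eq_1] by (simp add: distrib_right)
        with elim have "norm (orth (z t)) + norm ((p \<bullet> z t - 1) *\<^sub>R p) \<le> B * \<eta>"
          unfolding B_def distrib_right[of _ _ \<eta>] by linarith
        moreover have "z t - p = orth (z t) + (p \<bullet> z t - 1) *\<^sub>R p"
          by (simp add: scaleR_left_diff_distrib)
        ultimately show ?case using norm_triangle_le by metis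
      qed
    qed
  qed
  then show ?thesis using pos(5) by (intro exI conjI)
qed

end

section \<open>Averaging by the mixing matrix and consensus\<close>

text \<open>The Kronecker product of \<open>W\<close> with the identity, acting on the stack of all
  node vectors; the vector type supplies the Euclidean norm of the stack.\<close>

definition mix :: "real ^ 'm ^ 'm \<Rightarrow> 'v::real_vector ^ 'm \<Rightarrow> 'v ^ 'm" where
  "mix W y = (\<chi> i. \<Sum>j\<in>UNIV. (W $ i $ j) *\<^sub>R (y $ j))"

lemma linear_mix: "linear (mix W)"
  by (rule linearI)
    (simp_all add: mix_def vec_eq_iff scaleR_add_right sum.distrib scaleR_sum_right mult.commute)

text \<open>The parallel axis identity: second moment equals squared mean plus variance.\<close>

lemma weighted_variance:
  fixes y :: "'i \<Rightarrow> 'v::real_inner"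
  assumes "sum w A = 1" and m: "m = (\<Sum>j\<in>A. w j *\<^sub>R y j)"
  shows "(\<Sum>j\<in>A. w j * (y j \<bullet> y j)) = m \<bullet> m + (\<Sum>j\<in>A. w j * ((y j - m) \<bullet> (y j - m)))"
proof -
  have "(y j - m) \<bullet> (y j - m) = y j \<bullet> y j - 2 * (y j \<bullet> m) + m \<bullet> m" for j
    using inner_commute[of "y j" m] by (simp add: inner_simps)
  then have "(\<Sum>j\<in>A. w j * ((y j - m) \<bullet> (y j - m)))
      = (\<Sum>j\<in>A. w j * (y j \<bullet> y j)) - 2 * (\<Sum>j\<in>A. w j * (y j \<bullet> m)) + sum w A * (m \<bullet> m)"
    by (simp add: algebra_simps sum.distrib sum_subtractf sum_distrib_left sum_distrib_right)
  also have "(\<Sum>j\<in>A. w j * (y j \<bullet> m)) = m \<bullet> m"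
    unfolding m by (simp add: inner_sum_left)
  finally show ?thesis using assms by simp
qed

text \<open>Each row of \<open>W\<close> is a probability vector, so its second moment splits into
  squared mean and variance. Summed over the rows, the unit column sums turn the second moments into
  the squared norm of \<open>y\<close>; what averaging loses is the total variance.\<close>

lemma mix_norm_sq:
  fixes W :: "real ^ 'm::finite ^ 'm" and y :: "'v::real_inner ^ 'm"
  assumes "doubly_stochastic W"
  shows "(norm y)\<^sup>2 = (norm (mix W y))\<^sup>2
    + (\<Sum>i\<in>UNIV. \<Sum>j\<in>UNIV. W $ i $ j * (norm (y $ j - mix W y $ i))\<^sup>2)"
proof -
  have rows: "(\<Sum>j\<in>UNIV. W $ i $ j) = 1" and cols: "(\<Sum>i\<in>UNIV. W $ i $ j) = 1" for i j
    using assms by (auto simp: doubly_stochastic_def)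
  have "(norm y)\<^sup>2 = (\<Sum>j\<in>UNIV. (\<Sum>i\<in>UNIV. W $ i $ j) * (y $ j \<bullet> y $ j))"
    by (simp add: cols power2_norm_eq_inner inner_vec_def)
  also have "\<dots> = (\<Sum>i\<in>UNIV. \<Sum>j\<in>UNIV. W $ i $ j * (y $ j \<bullet> y $ j))"
    unfolding sum_distrib_right by (rule sum.swap)
  also have "\<dots> = (\<Sum>i\<in>UNIV. mix W y $ i \<bullet> mix W y $ i
      + (\<Sum>j\<in>UNIV. W $ i $ j * ((y $ j - mix W y $ i) \<bullet> (y $ j - mix W y $ i))))"
    by (intro sum.cong refl weighted_variance rows) (simp add: mix_def)
  finally show ?thesis by (simp add: sum.distrib power2_norm_eq_inner inner_vec_def)
qed

text \<open>Without loss of norm all row variances vanish, so \<open>y $ j\<close> equals the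
  average at \<open>i\<close> whenever \<open>W $ i $ j\<close> is nonzero. The nonzero diagonal
  ties \<open>y $ i\<close> to the same average, so adjacent nodes agree; by connectedness
  \<open>y\<close> is constant, and zero sum makes it 0.\<close>

lemma mix_norm_less:
  fixes y :: "'v::real_inner ^ 'm::finite"
  assumes conn: "connected_graph E" and W: "mixing_matrix E W"
    and zero: "(\<Sum>i\<in>UNIV. y $ i) = 0" and y: "y \<noteq> 0"
  shows "norm (mix W y) < norm y"
proof (rule ccontr)
  let ?v = "\<lambda>i j. W $ i $ j * (norm (y $ j - mix W y $ i))\<^sup>2"
  have ds: "doubly_stochastic W" using W by (simp add: mixing_matrix_def)
  have nn: "0 \<le> ?v i j" for i j using ds by (simp add: doubly_stochastic_def)
  assume "\<not> norm (mix W y) < norm y"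
  then have "(norm y)\<^sup>2 \<le> (norm (mix W y))\<^sup>2" by (intro power_mono) auto
  then have "(\<Sum>i\<in>UNIV. \<Sum>j\<in>UNIV. ?v i j) \<le> 0" using mix_norm_sq[OF ds, of y] by linarith
  then have "(\<Sum>i\<in>UNIV. \<Sum>j\<in>UNIV. ?v i j) = 0" using nn by (intro antisym sum_nonneg) auto
  then have "?v i j = 0" for i j
    using nn by (simp add: sum_nonneg_eq_0_iff sum_nonneg del: mult_eq_0_iff)
  then have eq: "y $ j = mix W y $ i" if "W $ i $ j \<noteq> 0" for i j
    using that by fastforce
  have edge: "y $ i = y $ j" if "E i j" for i j
  proof -
    have "i \<noteq> j" using that conn by (auto simp: connected_graph_def irreflp_def)
    then show ?thesis using that eq[of i i] eq[of i j] W by (simp add: mixing_matrix_def)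
  qed
  have "y $ i = y $ j" if "E\<^sup>*\<^sup>* i j" for i j
    using that by induction (use edge in auto)
  then have const: "y $ i = y $ j" for i j using conn by (simp add: connected_graph_def)
  have "y $ i = 0" for i
  proof -
    have "(\<Sum>j\<in>UNIV. y $ j) = real CARD('m) *\<^sub>R (y $ i)"
      by (subst const[of _ i]) (simp add: sum_constant_scaleR)
    then show ?thesis using zero by simp
  qed
  then show False using y by (simp add: vec_eq_iff)
qed

text \<open>Compactness of the unit sphere replaces the spectral gap of \<open>W\<close>.\<close>

lemma mix_contraction:
  assumes conn: "connected_graph E" and W: "mixing_matrix E W"
  obtains \<beta> where "0 \<le> \<beta>" "\<beta> < 1"
    "\<And>y :: 'v::euclidean_space ^ 'm::finite. (\<Sum>i\<in>UNIV. y $ i) = 0 \<Longrightarrow> norm (mix W y) \<le> \<beta> * norm y"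
proof -
  define K where "K = sphere 0 1 \<inter> {y :: 'v ^ 'm. (\<Sum>i\<in>UNIV. y $ i) = 0}"
  have "closed {y :: 'v ^ 'm. (\<Sum>i\<in>UNIV. y $ i) = 0}"
    by (intro closed_Collect_eq continuous_intros)
  then have comp: "compact K" unfolding K_def by (intro compact_Int_closed) auto
  have cont: "continuous_on K (\<lambda>y. norm (mix W y))"
    by (intro continuous_on_norm linear_continuous_on linear_conv_bounded_linear[THEN iffD1] linear_mix)
  obtain \<beta> where \<beta>: "0 \<le> \<beta>" "\<beta> < 1" "\<And>y. y \<in> K \<Longrightarrow> norm (mix W y) \<le> \<beta>"
  \<comment> \<open>With a single node the zero-sum subspace is trivial and the sphere misses
    it.\<close>
  proof (cases "K = {}")
    case True
    then show ?thesis using that[of 0] by simp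
  next
    case False
    then obtain u where u: "u \<in> K" "\<And>y. y \<in> K \<Longrightarrow> norm (mix W y) \<le> norm (mix W u)"
      using continuous_attains_sup[OF comp _ cont] by blast
    then have "norm (mix W u) < norm u" by (intro mix_norm_less[OF conn W]) (auto simp: K_def)
    then show ?thesis using u that[of "norm (mix W u)"] by (simp add: K_def)
  qed
  show ?thesis
  proof (rule that[OF \<beta>(1,2)])
    fix y :: "'v ^ 'm"
    assume y: "(\<Sum>i\<in>UNIV. y $ i) = 0"
    show "norm (mix W y) \<le> \<beta> * norm y"
    proof (cases "y = 0")
      case True
      then show ?thesis by (simp add: linear_0[OF linear_mix])
    next
      case False
      then have "(1 / norm y) *\<^sub>R y \<in> K"
        using y by (simp add: K_def scaleR_sum_right[symmetric])
      from \<beta>(3)[OF this] show ?thesis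
        using False by (simp add: linear_scale[OF linear_mix] field_simps)
    qed
  qed
qed

definition node_mean :: "('m::finite \<Rightarrow> 'v::real_vector) \<Rightarrow> 'v" where
  "node_mean x = (1 / real CARD('m)) *\<^sub>R (\<Sum>i\<in>UNIV. x i)"

lemma norm_node_mean_le:
  fixes x :: "'m::finite \<Rightarrow> 'v::real_normed_vector"
  assumes "\<And>i. norm (x i) \<le> r"
  shows "norm (node_mean x) \<le> r"
proof -
  have "norm (\<Sum>i\<in>UNIV. x i) \<le> real CARD('m) * r"
    using sum_norm_le[of UNIV x "\<lambda>_. r"] assms by simp
  then show ?thesis by (simp add: node_mean_def field_simps)
qed

text \<open>Unit column sums: mixing leaves the mean unchanged.\<close>

lemma node_mean_step:
  fixes W :: "real ^ 'm::finite ^ 'm"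
  assumes "doubly_stochastic W"
  shows "node_mean (\<lambda>i. (\<Sum>j\<in>UNIV. (W $ i $ j) *\<^sub>R x j) + \<alpha> *\<^sub>R g i) = node_mean x + \<alpha> *\<^sub>R node_mean g"
proof -
  have "(\<Sum>i\<in>UNIV. \<Sum>j\<in>UNIV. (W $ i $ j) *\<^sub>R x j) = (\<Sum>j\<in>UNIV. (\<Sum>i\<in>UNIV. W $ i $ j) *\<^sub>R x j)"
    unfolding scaleR_sum_left by (rule sum.swap)
  also have "\<dots> = (\<Sum>j\<in>UNIV. x j)" using assms by (simp add: doubly_stochastic_def)
  finally show ?thesis
    by (simp add: node_mean_def sum.distrib scaleR_add_right scaleR_sum_right[symmetric])
qed

text \<open>The stacked deviations from the mean start at 0, as all nodes share the initial vector,
  and in each step are contracted by \<beta> and receive at most \<open>\<alpha> * H\<close>. The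
  geometric series gives \<open>\<alpha> * H / (1 - \<beta>)\<close>. The constant is fixed before
  \<alpha> and the iterates.\<close>

lemma consensus:
  assumes conn: "connected_graph E" and W: "mixing_matrix E W" and G: "0 < G"
  obtains \<kappa> where "0 < \<kappa>"
    "\<And>\<alpha> x (g :: nat \<Rightarrow> 'm::finite \<Rightarrow> 'v::euclidean_space) t i. \<lbrakk>0 < \<alpha>; \<And>i. x 0 i = xinit;
      \<And>t i. x (Suc t) i = (\<Sum>j\<in>UNIV. (W $ i $ j) *\<^sub>R x t j) + \<alpha> *\<^sub>R g t i;
      \<And>t i. norm (g t i) \<le> G\<rbrakk> \<Longrightarrow> norm (x t i - node_mean (x t)) \<le> \<kappa> * \<alpha>"
proof -
  have ds: "doubly_stochastic W" using W by (simp add: mixing_matrix_def)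
  have rows: "(\<Sum>j\<in>UNIV. W $ i $ j) = 1" for i
    using ds by (simp add: doubly_stochastic_def)
  obtain \<beta> where \<beta>: "0 \<le> \<beta>" "\<beta> < 1"
    and contr: "\<And>y :: 'v ^ 'm. (\<Sum>i\<in>UNIV. y $ i) = 0 \<Longrightarrow> norm (mix W y) \<le> \<beta> * norm y"
    using mix_contraction[OF conn W] by blast
  define H where "H = real CARD('m) * (2 * G)"
  show ?thesis
  proof (rule that[of "H / (1 - \<beta>)"])
    show "0 < H / (1 - \<beta>)" using G \<beta> by (simp add: H_def)
  next
    fix \<alpha> x t i and g :: "nat \<Rightarrow> 'm \<Rightarrow> 'v"
    assume \<alpha>: "0 < \<alpha>" and x0: "\<And>i. x 0 i = xinit"
      and step: "\<And>t i. x (Suc t) i = (\<Sum>j\<in>UNIV. (W $ i $ j) *\<^sub>R x t j) + \<alpha> *\<^sub>R g t i"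
      and g: "\<And>t i. norm (g t i) \<le> G"
    define Y where "Y t = (\<chi> i. x t i - node_mean (x t))" for t
    define F where "F t = (\<chi> i. g t i - node_mean (g t))" for t
    have F: "norm (F t) \<le> H" for t
    proof -
      have "norm (F t) \<le> (\<Sum>i\<in>UNIV. norm (F t $ i))"
        unfolding norm_vec_def by (rule L2_set_le_sum) simp
      also have "\<dots> \<le> (\<Sum>i\<in>(UNIV::'m set). 2 * G)"
      proof (rule sum_mono)
        fix i
        have "norm (F t $ i) \<le> norm (g t i) + norm (node_mean (g t))"
          unfolding F_def by (simp add: norm_triangle_ineq4)
        then show "norm (F t $ i) \<le> 2 * G"
          using g[of t i] norm_node_mean_le[of "g t" G, OF g] by linarith
      qed
      finally show ?thesis by (simp add: H_def)
    qed
    have Y0: "Y 0 = 0"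
      by (simp add: Y_def vec_eq_iff node_mean_def x0 sum_constant_scaleR)
    have mz: "(\<Sum>i\<in>UNIV. Y t $ i) = 0" for t
      by (simp add: Y_def node_mean_def sum_subtractf sum_constant_scaleR)
    have YS: "Y (Suc t) = mix W (Y t) + \<alpha> *\<^sub>R F t" for t
    proof -
      have "node_mean (x (Suc t)) = node_mean (x t) + \<alpha> *\<^sub>R node_mean (g t)"
        using node_mean_step[OF ds, of "x t" \<alpha> "g t"] unfolding step[abs_def] .
      then show ?thesis
        by (simp add: vec_eq_iff Y_def F_def mix_def step scaleR_diff_right sum_subtractf
            scaleR_sum_left[symmetric] rows)
    qed
    have Y: "norm (Y t) \<le> H / (1 - \<beta>) * \<alpha>" for t
    proof (induction t)
      case 0
      then show ?case using Y0 G \<alpha> \<beta> by (simp add: H_def)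
    next
      case (Suc t)
      have "norm (Y (Suc t)) \<le> norm (mix W (Y t)) + norm (\<alpha> *\<^sub>R F t)"
        unfolding YS by (rule norm_triangle_ineq)
      also have "norm (mix W (Y t)) \<le> \<beta> * (H / (1 - \<beta>) * \<alpha>)"
        using contr[OF mz] Suc \<beta> by (meson mult_left_mono order_trans)
      also have "norm (\<alpha> *\<^sub>R F t) \<le> \<alpha> * H" using F \<alpha> by simp
      also have "\<beta> * (H / (1 - \<beta>) * \<alpha>) + \<alpha> * H = H / (1 - \<beta>) * \<alpha>"
        using \<beta> by (simp add: field_simps)
      finally show ?case by simp
    qed
    have "norm (Y t $ i) \<le> norm (Y t)" by (rule Finite_Cartesian_Product.norm_nth_le)
    then show "norm (x t i - node_mean (x t)) \<le> H / (1 - \<beta>) * \<alpha>"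
      using Y[of t] by (simp add: Y_def)
  qed
qed

section \<open>From the node mean to all nodes\<close>

lemma orthonormal_expansion:
  fixes q :: "nat \<Rightarrow> 'v::euclidean_space"
  assumes "orthonormal_family {1..DIM('v)} q"
  shows "x = (\<Sum>k\<in>{1..DIM('v)}. (q k \<bullet> x) *\<^sub>R q k)"
proof -
  let ?I = "{1..DIM('v)}"
  have on: "q k \<bullet> q k' = (if k = k' then 1 else 0)" if "k \<in> ?I" "k' \<in> ?I" for k k'
    using assms that by (simp add: orthonormal_family_def)
  have inj: "inj_on q ?I" using on by (metis inj_onI zero_neq_one)
  have "independent (q ` ?I)"
  proof (rule pairwise_orthogonal_independent)
    show "pairwise orthogonal (q ` ?I)"
      unfolding pairwise_def orthogonal_def using on by auto
    show "0 \<notin> q ` ?I" using on by (metis imageE inner_zero_left zero_neq_one)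
  qed
  then have span: "UNIV \<subseteq> span (q ` ?I)"
    by (intro card_ge_dim_independent) (use card_image[OF inj] in simp_all)
  define r where "r = x - (\<Sum>k\<in>?I. (q k \<bullet> x) *\<^sub>R q k)"
  have "orthogonal r (q k)" if k: "k \<in> ?I" for k
  proof -
    have "(\<Sum>k'\<in>?I. (q k' \<bullet> x) * (q k' \<bullet> q k)) = (\<Sum>k'\<in>?I. if k' = k then q k \<bullet> x else 0)"
      using on k by (intro sum.cong) auto
    then show ?thesis using k
      by (simp add: orthogonal_def r_def inner_diff_left inner_sum_left inner_commute[of x])
  qed
  then have "orthogonal r r" using span by (intro orthogonal_to_span[of r "q ` ?I"]) auto
  then show ?thesis by (simp add: orthogonal_self r_def)
qed

text \<open>The finitely many times before the bound holds are absorbed into the factor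
  \<open>A = R * 2 ^ N\<close>, so the fixed rate \<open>1 / 2\<close> serves.\<close>

lemma linear_rate_of_eventually:
  fixes f :: "nat \<Rightarrow> 'm::finite \<Rightarrow> real"
  assumes R: "0 < R" "\<And>t i. f t i \<le> R" and b: "0 \<le> b"
    and ev: "\<forall>\<^sub>F t in sequentially. \<forall>i. f t i \<le> b"
  shows "\<exists>A>0. \<forall>t i. f t i \<le> A * (1 / 2) ^ t + b"
proof -
  obtain N where N: "\<And>t i. t \<ge> N \<Longrightarrow> f t i \<le> b" using ev by (auto simp: eventually_sequentially)
  have "f t i \<le> R * 2 ^ N * (1 / 2) ^ t + b" for t i
  proof (cases "t \<ge> N")
    case True
    then show ?thesis using N[OF True, of i] R by (simp add: add_increasing)
  next
    case False
    then have "(1 / 2) ^ N \<le> (1 / 2 :: real) ^ t" by (intro power_decreasing) auto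
    then have "R * 2 ^ N * (1 / 2) ^ N \<le> R * 2 ^ N * (1 / 2) ^ t"
      using R by (intro mult_left_mono) auto
    moreover have "R * 2 ^ N * (1 / 2) ^ N = R" by (simp add: power_divide)
    ultimately show ?thesis using R(2)[of t i] b by linarith
  qed
  then show ?thesis using R by (intro exI[of _ "R * 2 ^ N"]) auto
qed

text \<open>The new iterate is a convex combination except for the Oja term. That term is grouped
  with the node's own share, which stays within \<open>W $ i $ i * sqrt 3\<close>; the other shares
  are bounded by their weights.\<close>

lemma distributed_oja_bounded:
  fixes x :: "nat \<Rightarrow> 'm::finite \<Rightarrow> 'v::real_inner" and W :: "real ^ 'm ^ 'm"
  assumes ds: "doubly_stochastic W" and S: "\<And>i. psd_operator (S i) l"
    and W: "\<And>i. 0 < W $ i $ i" and \<alpha>: "0 \<le> \<alpha>" "\<And>i. \<alpha> * l \<le> W $ i $ i / 3"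
    and x0: "\<And>i. norm (x 0 i) \<le> sqrt 3"
    and step: "\<And>t i. x (Suc t) i = (\<Sum>j\<in>UNIV. (W $ i $ j) *\<^sub>R x t j) + \<alpha> *\<^sub>R oja (S i) (x t i)"
  shows "norm (x t i) \<le> sqrt 3"
proof (induction t arbitrary: i)
  case (Suc t)
  have nn: "0 \<le> W $ i $ j" and row: "(\<Sum>j\<in>UNIV. W $ i $ j) = 1" for j
    using ds by (auto simp: doubly_stochastic_def)
  have "x (Suc t) i = (\<Sum>j\<in>UNIV - {i}. (W $ i $ j) *\<^sub>R x t j)
      + ((W $ i $ i) *\<^sub>R x t i + \<alpha> *\<^sub>R oja (S i) (x t i))"
    unfolding step by (simp add: sum.remove[of UNIV i])
  also have "norm \<dots> \<le> (\<Sum>j\<in>UNIV - {i}. W $ i $ j * sqrt 3) + W $ i $ i * sqrt 3"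
  proof (rule norm_triangle_mono)
    show "norm (\<Sum>j\<in>UNIV - {i}. (W $ i $ j) *\<^sub>R x t j) \<le> (\<Sum>j\<in>UNIV - {i}. W $ i $ j * sqrt 3)"
      using nn Suc by (intro sum_norm_le) (simp add: mult_left_mono)
    show "norm ((W $ i $ i) *\<^sub>R x t i + \<alpha> *\<^sub>R oja (S i) (x t i)) \<le> W $ i $ i * sqrt 3"
      by (rule psd_operator.oja_step_bounded[OF S W \<alpha> Suc])
  qed
  also have "\<dots> = (\<Sum>j\<in>UNIV. W $ i $ j) * sqrt 3"
    by (simp add: sum.remove[of UNIV i] sum_distrib_right distrib_right)
  finally show ?case by (simp add: row)
qed (rule x0)

text \<open>Additivity in the operator: the mean of the local fields is the global field divided by
  the number of nodes, whence the effective step \<open>\<alpha> / M\<close>.\<close>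

lemma oja_sum:
  "oja (\<lambda>x. \<Sum>i\<in>A. S i x) x = (\<Sum>i\<in>A. oja (S i) x)"
  unfolding oja_def inner_sum_right scaleR_sum_left sum_subtractf ..

lemma distributed_oja_converges:
  fixes W :: "real ^ 'm::finite ^ 'm" and S :: "'m \<Rightarrow> 'v::euclidean_space \<Rightarrow> 'v"
  assumes conn: "connected_graph E" and W: "mixing_matrix E W"
    and S: "\<And>i. psd_operator (S i) l"
    and gap: "oja_gap (\<lambda>x. \<Sum>i\<in>UNIV. S i x) l p \<gamma>"
    and xinit: "norm xinit = 1" "0 < p \<bullet> xinit"
  shows "\<exists>B>0. \<forall>\<alpha> x. 0 < \<alpha> \<longrightarrow> (\<forall>i. \<alpha> * l \<le> W $ i $ i / 3) \<longrightarrow> x 0 = (\<lambda>_. xinit) \<longrightarrow>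
      (\<forall>t i. x (Suc t) i = (\<Sum>j\<in>UNIV. (W $ i $ j) *\<^sub>R x t j) + \<alpha> *\<^sub>R oja (S i) (x t i)) \<longrightarrow>
      (\<exists>A>0. \<forall>t i. norm (x t i - p) \<le> A * (1 / 2) ^ t + B * \<alpha>)"
proof -
  interpret oja_gap "\<lambda>x. \<Sum>i\<in>UNIV. S i x" l p \<gamma> by (rule gap)
  let ?T = "\<lambda>x. \<Sum>i\<in>UNIV. S i x"
  define M where "M = real CARD('m)"
  have M: "0 < M" by (simp add: M_def)
  have ds: "doubly_stochastic W" using W by (simp add: mixing_matrix_def)
  have Wii: "0 < W $ i $ i" for i
    using W ds by (simp add: mixing_matrix_def doubly_stochastic_def less_le)
  have p_norm: "norm p = 1" using p_unit by (simp add: norm_eq_1)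
  have a0: "p \<bullet> xinit \<le> 1"
    using Cauchy_Schwarz_ineq2[of p xinit] xinit p_norm by simp
  \<comment> \<open>Bound on the Oja field over the invariant ball:
    \<open>(1 + 3 * r^2) * l * r\<close> at \<open>r = sqrt 3\<close>.\<close>
  have G: "0 < 10 * l * sqrt 3" using l_pos by simp
  obtain \<kappa> where \<kappa>: "0 < \<kappa>"
    and cons: "\<And>\<alpha> x (g :: nat \<Rightarrow> 'm \<Rightarrow> 'v) t i. \<lbrakk>0 < \<alpha>; \<And>i. x 0 i = xinit;
      \<And>t i. x (Suc t) i = (\<Sum>j\<in>UNIV. (W $ i $ j) *\<^sub>R x t j) + \<alpha> *\<^sub>R g t i;
      \<And>t i. norm (g t i) \<le> 10 * l * sqrt 3\<rbrakk> \<Longrightarrow> norm (x t i - node_mean (x t)) \<le> \<kappa> * \<alpha>"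
    using consensus[OF conn W G] by blast
  \<comment> \<open>Lipschitz constant \<open>10 * l\<close> times deviation
    \<open>\<kappa> * \<alpha>\<close> times step \<alpha>, rewritten with
    \<open>\<alpha> = M * \<eta>\<close>.\<close>
  define c where "c = 10 * l * \<kappa> * M\<^sup>2"
  have c: "0 \<le> c" using l_pos \<kappa> by (simp add: c_def)
  obtain B \<eta>0 where B: "0 < B" and \<eta>0: "0 < \<eta>0"
    and oja: "\<And>\<eta> z. \<lbrakk>0 < \<eta>; \<eta> < \<eta>0; norm (z 0) = 1; p \<bullet> xinit \<le> p \<bullet> z 0;
      \<And>t. norm (z (Suc t) - (z t + \<eta> *\<^sub>R oja ?T (z t))) \<le> c * \<eta>\<^sup>2\<rbrakk> \<Longrightarrow>
      \<forall>\<^sub>F t in sequentially. norm (z t - p) \<le> B * \<eta>"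
    using perturbed_oja_converges[OF xinit(2) a0 c] unfolding eventually_at_right_field by blast
  \<comment> \<open>The summands cover the distance of the mean from \<open>p\<close>, the deviation
    of a node from the mean, and step sizes with \<open>\<alpha> / M >= \<eta>0\<close>, for which
    the last term times \<alpha> exceeds the trivial distance bound 3.\<close>
  define B' where "B' = B / M + \<kappa> + 3 / (M * \<eta>0)"
  have B': "0 < B'" using B M \<kappa> \<eta>0 by (simp add: B'_def add_pos_pos)
  have "\<exists>A>0. \<forall>t i. norm (x t i - p) \<le> A * (1 / 2) ^ t + B' * \<alpha>"
    if \<alpha>: "0 < \<alpha>" "\<forall>i. \<alpha> * l \<le> W $ i $ i / 3" and x0: "x 0 = (\<lambda>_. xinit)"
      and step: "\<forall>t i. x (Suc t) i = (\<Sum>j\<in>UNIV. (W $ i $ j) *\<^sub>R x t j) + \<alpha> *\<^sub>R oja (S i) (x t i)"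
    for \<alpha> x
  proof -
    have bdd: "norm (x t i) \<le> sqrt 3" for t i
      by (rule distributed_oja_bounded[OF ds S Wii, where \<alpha> = \<alpha>]) (use \<alpha> x0 step xinit in auto)
    have bdd3: "norm (x t i - p) \<le> 3" for t i
    proof -
      have "sqrt 3 \<le> 2" by (rule real_le_lsqrt) auto
      then show ?thesis using norm_triangle_ineq4[of "x t i" p] bdd[of t i] p_norm by linarith
    qed
    have "\<forall>\<^sub>F t in sequentially. \<forall>i. norm (x t i - p) \<le> B' * \<alpha>"
    proof (cases "\<alpha> / M < \<eta>0")
      case False
      then have "3 \<le> 3 / (M * \<eta>0) * \<alpha>" using M \<eta>0 by (simp add: field_simps)
      also have "\<dots> \<le> B' * \<alpha>"
        using \<alpha> B M \<kappa> by (intro mult_right_mono) (auto simp: B'_def)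
      finally have "norm (x t i - p) \<le> B' * \<alpha>" for t i using bdd3[of t i] by linarith
      then show ?thesis by simp
    next
      case True
      define z where "z t = node_mean (x t)" for t
      define \<eta> where "\<eta> = \<alpha> / M"
      have dev: "norm (x t i - z t) \<le> \<kappa> * \<alpha>" for t i
        unfolding z_def
      proof (rule cons[where g = "\<lambda>t i. oja (S i) (x t i)"])
        show "norm (oja (S i) (x t i)) \<le> 10 * l * sqrt 3" for t i
          using psd_operator.oja_norm_le[OF S bdd] by simp
      qed (use \<alpha> x0 step in auto)
      have z_bdd: "norm (z t) \<le> sqrt 3" for t
        unfolding z_def by (rule norm_node_mean_le[OF bdd])
      have "norm (z (Suc t) - (z t + \<eta> *\<^sub>R oja ?T (z t))) \<le> c * \<eta>\<^sup>2" for t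
      proof -
        have "z (Suc t) = z t + \<alpha> *\<^sub>R node_mean (\<lambda>i. oja (S i) (x t i))"
          unfolding z_def node_mean_step[OF ds, symmetric] using step by presburger
        then have "z (Suc t) - (z t + \<eta> *\<^sub>R oja ?T (z t))
            = \<alpha> *\<^sub>R node_mean (\<lambda>i. oja (S i) (x t i) - oja (S i) (z t))"
          unfolding oja_sum by (simp add: node_mean_def \<eta>_def M_def sum_subtractf scaleR_diff_right)
        moreover have "norm (node_mean (\<lambda>i. oja (S i) (x t i) - oja (S i) (z t))) \<le> 10 * l * (\<kappa> * \<alpha>)"
        proof (rule norm_node_mean_le)
          fix i
          have "norm (oja (S i) (x t i) - oja (S i) (z t)) \<le> 10 * l * norm (x t i - z t)"
            using psd_operator.oja_lipschitz[OF S bdd z_bdd] by simp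
          also have "\<dots> \<le> 10 * l * (\<kappa> * \<alpha>)" using dev l_pos by (intro mult_left_mono) auto
          finally show "norm (oja (S i) (x t i) - oja (S i) (z t)) \<le> 10 * l * (\<kappa> * \<alpha>)" .
        qed
        ultimately have "norm (z (Suc t) - (z t + \<eta> *\<^sub>R oja ?T (z t))) \<le> \<alpha> * (10 * l * (\<kappa> * \<alpha>))"
          using \<alpha> by simp
        also have "\<dots> = c * \<eta>\<^sup>2" using M by (simp add: c_def \<eta>_def power2_eq_square)
        finally show ?thesis .
      qed
      moreover have "z 0 = xinit" by (simp add: z_def x0 node_mean_def sum_constant_scaleR)
      ultimately have "\<forall>\<^sub>F t in sequentially. norm (z t - p) \<le> B * \<eta>"
        using True \<alpha> M xinit by (intro oja) (auto simp: \<eta>_def)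
      then show ?thesis
      proof eventually_elim
        case (elim t)
        have "0 \<le> 3 / (M * \<eta>0) * \<alpha>" using M \<eta>0 \<alpha> by simp
        then have "B * \<eta> + \<kappa> * \<alpha> \<le> B' * \<alpha>" by (simp add: B'_def \<eta>_def distrib_right)
        then have "norm (x t i - p) \<le> B' * \<alpha>" for i
          using elim dev[of t i] norm_triangle_ineq[of "x t i - z t" "z t - p"] by simp
        then show ?case by simp
      qed
    qed
    then show ?thesis
      by (intro linear_rate_of_eventually[where f = "\<lambda>t i. norm (x t i - p)" and R = 3])
        (use B' \<alpha> bdd3 in auto)
  qed
  then show ?thesis using B' by blast
qed

section \<open>Spectral data of the covariance matrices and the theorem\<close>

lemma sanger_spectrum_mono:
  assumes "sanger_spectrum K n lam" and "1 \<le> j" "j \<le> k" "k \<le> n"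
  shows "lam k \<le> lam j"
  using assms(3,4)
proof (induction k rule: dec_induct)
  case (step k)
  have "lam (k + 1) \<le> lam k"
  proof (cases "k \<le> K")
    case True
    then show ?thesis
      using assms(1,2) step by (intro less_imp_le) (simp add: sanger_spectrum_def)
  next
    case False
    then show ?thesis using assms(1) step by (simp add: sanger_spectrum_def)
  qed
  then show ?case using step by simp
qed simp

text \<open>The gap is \<open>lam 1 - lam 2\<close>. In dimension 1 there is no second eigenvalue,
  and \<open>lam 1\<close> is taken instead; either choice is at most \<open>lam 1\<close>.\<close>

lemma sanger_spectrum_gap:
  assumes sp: "sanger_spectrum K n lam"
  obtains \<gamma> where "0 < \<gamma>" "\<gamma> \<le> lam 1" "\<And>k. k \<in> {2..n} \<Longrightarrow> lam k \<le> lam 1 - \<gamma>"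
proof (cases "n = 1")
  case True
  moreover have "0 < lam 1" using sp True by (auto simp: sanger_spectrum_def le_Suc_eq)
  ultimately show ?thesis by (intro that[of "lam 1"]) auto
next
  case False
  then have n: "2 \<le> n" using sp by (auto simp: sanger_spectrum_def)
  then have "lam (1 + 1) < lam 1" using sp unfolding sanger_spectrum_def by force
  moreover have "0 \<le> lam 2"
    using sanger_spectrum_mono[OF sp, of 2 n] n sp by (simp add: sanger_spectrum_def)
  moreover have "lam k \<le> lam 2" if "k \<in> {2..n}" for k
    using sanger_spectrum_mono[OF sp, of 2 k] that by simp
  ultimately show ?thesis by (intro that[of "lam 1 - lam 2"]) (auto simp: numeral_2_eq_2)
qed

lemma orthonormal_rayleigh:
  fixes q :: "nat \<Rightarrow> 'v::euclidean_space"
  assumes q: "orthonormal_family {1..DIM('v)} q" and "linear S"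
    and eig: "\<And>k. k \<in> {1..DIM('v)} \<Longrightarrow> S (q k) = lam k *\<^sub>R q k"
  shows "u \<bullet> u = (\<Sum>k\<in>{1..DIM('v)}. (q k \<bullet> u)\<^sup>2)"
    and "u \<bullet> S u = (\<Sum>k\<in>{1..DIM('v)}. lam k * (q k \<bullet> u)\<^sup>2)"
proof -
  let ?I = "{1..DIM('v)}"
  note ex = orthonormal_expansion[OF q, of u]
  have "u \<bullet> u = u \<bullet> (\<Sum>k\<in>?I. (q k \<bullet> u) *\<^sub>R q k)" by (subst ex[symmetric]) simp
  then show "u \<bullet> u = (\<Sum>k\<in>?I. (q k \<bullet> u)\<^sup>2)"
    by (simp add: inner_sum_right power2_eq_square inner_commute[of u "q k" for k])
  have "S u = (\<Sum>k\<in>?I. (q k \<bullet> u) *\<^sub>R S (q k))"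
    by (subst ex) (simp add: linear_sum[OF assms(2)] linear_scale[OF assms(2)])
  also have "\<dots> = (\<Sum>k\<in>?I. (q k \<bullet> u) *\<^sub>R (lam k *\<^sub>R q k))"
    by (intro sum.cong refl) (simp only: eig)
  finally show "u \<bullet> S u = (\<Sum>k\<in>?I. lam k * (q k \<bullet> u)\<^sup>2)"
    by (simp add: inner_sum_right power2_eq_square inner_commute[of u "q k" for k] mult_ac)
qed

lemma symmetric_matrix_inner:
  assumes "symmetric_matrix A"
  shows "x \<bullet> (A *v y) = (A *v x) \<bullet> y"
  using assms unfolding symmetric_matrix_def
  by (simp flip: dot_lmul_matrix transpose_matrix_vector)

text \<open>\<open>W\<close> vanishes off the closed neighborhood, so the local sum is a full row of
  \<open>W\<close> and the iteration takes the form used for mixing.\<close>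

lemma dsa_Suc:
  assumes "mixing_matrix E W"
  shows "dsa E W C \<alpha> x0 (Suc t) i
    = (\<Sum>j\<in>UNIV. (W $ i $ j) *\<^sub>R dsa E W C \<alpha> x0 t j) + \<alpha> *\<^sub>R oja ((*v) (C i)) (dsa E W C \<alpha> x0 t i)"
proof -
  have "W $ i $ j = 0" if "j \<notin> neighbors E i \<union> {i}" for j
    using assms that unfolding mixing_matrix_def neighbors_def
    by (metis UnI1 UnI2 mem_Collect_eq singletonI)
  then have "(\<Sum>j\<in>neighbors E i \<union> {i}. (W $ i $ j) *\<^sub>R dsa E W C \<alpha> x0 t j)
      = (\<Sum>j\<in>UNIV. (W $ i $ j) *\<^sub>R dsa E W C \<alpha> x0 t j)"
    by (intro sum.mono_neutral_left) auto
  then show ?thesis by (simp add: oja_def)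
qed

theorem theorem2:
  fixes E :: "'m::finite \<Rightarrow> 'm \<Rightarrow> bool"
    and W :: "real ^ 'm ^ 'm"
    and C :: "'m \<Rightarrow> real ^ 'd ^ 'd"
    and Cglob :: "real ^ 'd ^ 'd"
    and q :: "nat \<Rightarrow> real ^ 'd"
    and lam :: "nat \<Rightarrow> real"
    and K :: nat
    and x0 :: "'m \<Rightarrow> real ^ 'd"
    and xinit :: "real ^ 'd"
  assumes "connected_graph E"
    and "mixing_matrix E W"
    and "\<And>i. psd_matrix (C i)"
    and "Cglob = (\<Sum>i\<in>UNIV. C i)"
    and "orthonormal_family {1..CARD('d)} q"
    and "\<And>k. k \<in> {1..CARD('d)} \<Longrightarrow> Cglob *v q k = lam k *\<^sub>R q k"
    and "sanger_spectrum K CARD('d) lam"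
    and "\<And>i. x0 i = xinit"
    and "\<And>i. q 1 \<bullet> x0 i \<noteq> 0"
    and "\<And>i. norm (x0 i) = 1"
  shows "\<exists>B>0. \<forall>\<alpha>. 0 < \<alpha> \<and> \<alpha> \<le> (MIN i. W $ i $ i) / (3 * lam 1 * (2 * real K - 1)) \<longrightarrow>
           (\<exists>A>0. \<exists>\<theta>. 0 < \<theta> \<and> \<theta> < 1 \<and> (\<exists>xstar\<in>{q 1, - q 1}.
              \<forall>t i. norm (dsa E W C \<alpha> x0 t i - xstar) \<le> A * \<theta> ^ t + B * \<alpha>))"
proof -
  have sp: "sanger_spectrum K CARD('d) lam" and K: "1 \<le> K" using assms(7) by (auto simp: sanger_spectrum_def)
  have q: "orthonormal_family {1..DIM(real ^ 'd)} q" using assms(5) by simp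
  have eig: "\<And>k. k \<in> {1..DIM(real ^ 'd)} \<Longrightarrow> Cglob *v q k = lam k *\<^sub>R q k" using assms(6) by simp
  have rayleigh: "u \<bullet> u = (\<Sum>k\<in>{1..CARD('d)}. (q k \<bullet> u)\<^sup>2)"
    "u \<bullet> (Cglob *v u) = (\<Sum>k\<in>{1..CARD('d)}. lam k * (q k \<bullet> u)\<^sup>2)" for u
    using orthonormal_rayleigh[OF q matrix_vector_mul_linear, of Cglob lam u] eig by simp_all
  have one: "1 \<in> {1..CARD('d)}" by (simp add: Suc_leI)
  have glob: "(\<Sum>i\<in>UNIV. C i *v v) = Cglob *v v" for v
    unfolding assms(4)
    by (simp add: vec_eq_iff matrix_vector_mult_def sum_distrib_right sum.swap[of _ UNIV "UNIV :: 'm set"])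
  obtain \<gamma> where \<gamma>: "0 < \<gamma>" "\<gamma> \<le> lam 1" "\<And>k. k \<in> {2..CARD('d)} \<Longrightarrow> lam k \<le> lam 1 - \<gamma>"
    using sanger_spectrum_gap[OF sp] by blast
  have upper: "v \<bullet> (Cglob *v v) \<le> lam 1 * (v \<bullet> v)" for v
    unfolding rayleigh sum_distrib_left
    using sanger_spectrum_mono[OF sp, of 1] by (intro sum_mono mult_right_mono) auto
  have psd: "symmetric_matrix (C i)" "0 \<le> v \<bullet> (C i *v v)" for i v
    using assms(3) by (auto simp: psd_matrix_def)
  \<comment> \<open>The other local forms are nonnegative, so \<open>lam 1\<close> bounds every
    local Rayleigh quotient.\<close>
  have local_le: "v \<bullet> (C i *v v) \<le> v \<bullet> (Cglob *v v)" for i v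
    unfolding glob[symmetric] inner_sum_right by (rule member_le_sum) (auto simp: psd)
  have S: "psd_operator ((*v) (C i)) (lam 1)" for i
  proof (rule psd_operator.intro)
    show "v \<bullet> (C i *v v) \<le> lam 1 * (v \<bullet> v)" for v
      using local_le[of v i] upper[of v] by linarith
    show "x \<bullet> (C i *v y) = (C i *v x) \<bullet> y" for x y
      by (rule symmetric_matrix_inner[OF psd(1)])
  qed (use \<gamma> psd(2) in auto)
  have gapS: "oja_gap (\<lambda>x. \<Sum>i\<in>UNIV. C i *v x) (lam 1) p \<gamma>" if p: "p \<in> {q 1, - q 1}" for p
    unfolding glob
  proof (intro oja_gap.intro psd_operator.intro oja_gap_axioms.intro)
    show "linear ((*v) Cglob)" by simp
    show "x \<bullet> (Cglob *v y) = (Cglob *v x) \<bullet> y" for x y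
      unfolding glob[symmetric] inner_sum_left inner_sum_right
      by (intro sum.cong refl symmetric_matrix_inner psd)
    show "0 \<le> x \<bullet> (Cglob *v x)" for x
      unfolding glob[symmetric] inner_sum_right by (intro sum_nonneg psd)
    show "p \<bullet> p = 1" using p assms(5) one by (auto simp: orthonormal_family_def)
    show "Cglob *v p = lam 1 *\<^sub>R p"
      using p assms(6)[OF one] by (auto simp: linear_neg[OF matrix_vector_mul_linear])
    show "u \<bullet> (Cglob *v u) \<le> (lam 1 - \<gamma>) * (u \<bullet> u)" if "p \<bullet> u = 0" for u
      unfolding rayleigh sum_distrib_left
    proof (rule sum_mono)
      fix k assume k: "k \<in> {1..CARD('d)}"
      \<comment> \<open>This removes the term \<open>k = 1\<close>, the only one whose eigenvalue
        exceeds \<open>lam 1 - \<gamma>\<close>.\<close>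
      have "q 1 \<bullet> u = 0" using that p by auto
      then show "lam k * (q k \<bullet> u)\<^sup>2 \<le> (lam 1 - \<gamma>) * (q k \<bullet> u)\<^sup>2"
        using \<gamma>(3)[of k] k by (cases "k = 1") (auto intro: mult_right_mono)
    qed
  qed (use \<gamma> upper in auto)
  have xinit: "norm xinit = 1" "q 1 \<bullet> xinit \<noteq> 0" using assms(8-10) by auto
  have x0: "x0 = (\<lambda>_. xinit)" using assms(8) by auto
  \<comment> \<open>The sign of the limit is that of the initial component along \<open>q 1\<close>,
    and the same for every \<alpha>.\<close>
  obtain p where p: "p \<in> {q 1, - q 1}" "0 < p \<bullet> xinit"
  proof (cases "0 < q 1 \<bullet> xinit")
    case False
    then show ?thesis using xinit that[of "- q 1"] by auto
  qed (use that in auto)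
  obtain B where B: "0 < B"
    and conv: "\<And>\<alpha> x. \<lbrakk>0 < \<alpha>; \<forall>i. \<alpha> * lam 1 \<le> W $ i $ i / 3; x 0 = (\<lambda>_. xinit);
      \<forall>t i. x (Suc t) i = (\<Sum>j\<in>UNIV. (W $ i $ j) *\<^sub>R x t j) + \<alpha> *\<^sub>R oja ((*v) (C i)) (x t i)\<rbrakk> \<Longrightarrow>
      \<exists>A>0. \<forall>t i. norm (x t i - p) \<le> A * (1 / 2) ^ t + B * \<alpha>"
    using distributed_oja_converges[OF assms(1,2) S gapS[OF p(1)] xinit(1) p(2)] by blast
  have "\<exists>A>0. \<exists>\<theta>. 0 < \<theta> \<and> \<theta> < 1 \<and> (\<exists>xstar\<in>{q 1, - q 1}.
      \<forall>t i. norm (dsa E W C \<alpha> x0 t i - xstar) \<le> A * \<theta> ^ t + B * \<alpha>)"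
    if \<alpha>: "0 < \<alpha>" "\<alpha> \<le> (MIN i. W $ i $ i) / (3 * lam 1 * (2 * real K - 1))" for \<alpha>
  proof -
    have step_size: "\<alpha> * lam 1 \<le> W $ i $ i / 3" for i
    proof -
      \<comment> \<open>Since \<open>2 * K - 1 >= 1\<close>, the step size bound yields
        \<open>\<alpha> * lam 1 <= W $ i $ i / 3\<close>, the condition for the invariant
        ball.\<close>
      have l: "0 < lam 1" and K': "1 \<le> 2 * real K - 1" using \<gamma> K by auto
      have "\<alpha> * (3 * lam 1) * 1 \<le> \<alpha> * (3 * lam 1) * (2 * real K - 1)"
        using \<alpha>(1) l K' by (intro mult_left_mono) auto
      also have "\<dots> \<le> (MIN i. W $ i $ i)"
        using \<alpha>(2) l K' by (simp add: pos_le_divide_eq mult.assoc)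
      also have "\<dots> \<le> W $ i $ i" by (intro Min_le) auto
      finally show ?thesis by simp
    qed
    have "dsa E W C \<alpha> x0 0 = (\<lambda>_. xinit)" using x0 by simp
    then obtain A where "0 < A" "\<forall>t i. norm (dsa E W C \<alpha> x0 t i - p) \<le> A * (1 / 2) ^ t + B * \<alpha>"
      using conv[of \<alpha> "dsa E W C \<alpha> x0"] \<alpha>(1) step_size dsa_Suc[OF assms(2)] by blast
    then show ?thesis using p(1)
      by (intro exI[of _ A] conjI exI[of _ "1 / 2"]) auto
  qed
  then show ?thesis using B by blast
qed

end
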